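(* Let $\mathcal I$ be an input space and $\mathcal O$ be an output space. (a) If a learning rule $A$ is $\rho$-replicable, then it is also $\rho$-TV indistinguishable. (b) Consider a prior distribution $\mathcal P$ over $\mathcal O$. Let $A$ be a learning rule that is $\rho$-TV indistinguishable and absolutely continuous with respect to $\mathcal P$. Then there exists a learning rule $A'$ that is equivalent to $A$ and is $\frac{2\rho}{1+\rho}$-replicable.
   Context: A learning rule is a randomized map $A$ from $\mathcal I$ to $\mathcal O$; $A(I)$ denotes the output distribution over $\mathcal O$ on input $I$. It can be implemented as $A:\mathcal I\times\mathcal R\to\mathcal O$, deterministic in $(I,r)$, where $r\sim\mathcal R$ is internal randomness ($\mathcal R$ a probability space) and $A(I)$ is the law of $A(I,r)$. $A$ is $\rho$-replicable (with internal randomness $\mathcal R$) if for every distribution $\mu$ over $\mathcal I$, $\Pr_{I,I'\sim\mu,\,r\sim\mathcal R}[A(I,r)\ne A(I',r)]\le\rho$, with $I,I',r$ independent. (In (b), $A'$ is replicable for a suitable choice of $\mathcal R$ and implementation.) $A$ is $\rho$-TV indistinguishable if for every distribution $\mu$ over $\mathcal I$ and independent $I,I'\sim\mu$, $\mathbf E_{I,I'}[d_{\mathrm{TV}}(A(I),A(I'))]\le\rho$. $A$ is absolutely continuous with respect to $\mathcal P$ if for every distribution $\mu$ over $\mathcal I$ and $\mu$-almost every $I$, $A(I)$ is absolutely continuous with respect to $\mathcal P$. $A,A'$ are equivalent if $A(I)=A'(I)$ as distributions for every $I\in\mathcal I$.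
   Formalization: The output space is assumed to have a countably generated sigma-algebra separating points; without this (b) fails for outputs {0,1}^[0,1] with the product sigma-algebra, and the probabilities and expected TV distance in the statement may be undefined. *)

theory Defs
  imports "HOL-Probability.Probability"
begin

text \<open>
  The input space \<open>M\<close>, the output space \<open>N\<close> and the space of internal randomness \<open>R\<close> are
  measurable spaces. The first two are given as values of type \<open>measure\<close> of which only the
  underlying set and the sigma-algebra matter. The distributions over \<open>M\<close> are the elements of
  \<open>space (prob_algebra M)\<close>.
\<close>

text \<open>
  Standing regularity of output spaces. The diagonal must be measurable for the event
  \<open>F I r \<noteq> F I' r\<close> to have a probability, and a countable generator makes
  \<open>tv_dist N (A I) (A I')\<close> measurable in \<open>(I, I')\<close>. Countable sets with all subsets measurable,
  Polish spaces with their Borel sets, and arbitrary subspaces of these qualify.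
\<close>

definition separated_countably_generated :: "'b measure \<Rightarrow> bool" where
  "separated_countably_generated N \<longleftrightarrow>
     (\<exists>G. countable G \<and> G \<subseteq> Pow (space N) \<and> sets N = sigma_sets (space N) G) \<and>
     (\<forall>x\<in>space N. \<forall>y\<in>space N. x \<noteq> y \<longrightarrow> (\<exists>S\<in>sets N. x \<in> S \<and> y \<notin> S))"

definition learning_rule :: "'a measure \<Rightarrow> 'b measure \<Rightarrow> ('a \<Rightarrow> 'b measure) \<Rightarrow> bool" where
  "learning_rule M N A \<longleftrightarrow> A \<in> M \<rightarrow>\<^sub>M prob_algebra N"

definition implements ::
  "'a measure \<Rightarrow> 'b measure \<Rightarrow> 'r measure \<Rightarrow> ('a \<Rightarrow> 'r \<Rightarrow> 'b) \<Rightarrow> ('a \<Rightarrow> 'b measure) \<Rightarrow> bool" where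
  "implements M N R F A \<longleftrightarrow>
     prob_space R \<and>
     (\<lambda>(I, r). F I r) \<in> M \<Otimes>\<^sub>M R \<rightarrow>\<^sub>M N \<and>
     (\<forall>I\<in>space M. distr R N (F I) = A I)"

text \<open>
  The library functions \<open>measure\<close> and \<open>integral\<^sup>L\<close> return \<open>0\<close> outside their domain. The next two
  definitions therefore require explicitly that the event is measurable, respectively that the
  distance is integrable.
\<close>

definition replicable :: "'a measure \<Rightarrow> 'r measure \<Rightarrow> ('a \<Rightarrow> 'r \<Rightarrow> 'b) \<Rightarrow> real \<Rightarrow> bool" where
  "replicable M R F \<rho> \<longleftrightarrow>
     (\<forall>\<mu>\<in>space (prob_algebra M).
        Measurable.pred ((\<mu> \<Otimes>\<^sub>M \<mu>) \<Otimes>\<^sub>M R) (\<lambda>((I, I'), r). F I r \<noteq> F I' r) \<and>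
        \<P>(((I, I'), r) in (\<mu> \<Otimes>\<^sub>M \<mu>) \<Otimes>\<^sub>M R. F I r \<noteq> F I' r) \<le> \<rho>)"

definition tv_dist :: "'b measure \<Rightarrow> 'b measure \<Rightarrow> 'b measure \<Rightarrow> real" where
  "tv_dist N P Q = (SUP S\<in>sets N. \<bar>measure P S - measure Q S\<bar>)"

definition tv_indistinguishable ::
  "'a measure \<Rightarrow> 'b measure \<Rightarrow> ('a \<Rightarrow> 'b measure) \<Rightarrow> real \<Rightarrow> bool" where
  "tv_indistinguishable M N A \<rho> \<longleftrightarrow>
     (\<forall>\<mu>\<in>space (prob_algebra M).
        integrable (\<mu> \<Otimes>\<^sub>M \<mu>) (\<lambda>(I, I'). tv_dist N (A I) (A I')) \<and>
        (\<integral>(I, I'). tv_dist N (A I) (A I') \<partial>(\<mu> \<Otimes>\<^sub>M \<mu>)) \<le> \<rho>)"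

definition abs_continuous_rule :: "'a measure \<Rightarrow> 'b measure \<Rightarrow> ('a \<Rightarrow> 'b measure) \<Rightarrow> bool" where
  "abs_continuous_rule M P A \<longleftrightarrow>
     (\<forall>\<mu>\<in>space (prob_algebra M). AE I in \<mu>. absolutely_continuous P (A I))"

definition equivalent_rules ::
  "'a measure \<Rightarrow> ('a \<Rightarrow> 'b measure) \<Rightarrow> ('a \<Rightarrow> 'b measure) \<Rightarrow> bool" where
  "equivalent_rules M A A' \<longleftrightarrow> (\<forall>I\<in>space M. A I = A' I)"

text \<open>
  An existential over a probability space of internal randomness needs a fixed carrier type.
  This one holds countable families of candidate outputs with two real numbers attached to
  each. The sigma-algebra and the distribution on it are left to the existential.
\<close>

type_synonym 'b seed = "nat \<times> nat \<Rightarrow> 'b \<times> real \<times> real"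

end

theory Submission
  imports Defs
begin

text \<open>
  Part (a): for fixed inputs, shared randomness is a coupling of the two output laws, and the
  total variation distance is at most the probability that coupled variables differ.

  Part (b): let \<open>f (I, \<cdot>)\<close> be the density of \<open>A I\<close> with respect to \<open>P\<close>, chosen jointly measurable.
  The shared randomness is a Poisson process with intensity \<open>P \<times> dy \<times> dt\<close> over outputs, heights
  \<open>y \<ge> 0\<close> and times, and the new rule outputs the first point in time with \<open>y < f (I, \<cdot>)\<close>. The first
  point in a region of finite area is uniform on that region. So the rule has law \<open>A I\<close>, and for
  inputs \<open>I, I'\<close> the first point below \<open>max (f (I, \<cdot>)) (f (I', \<cdot>))\<close> is common to both runs if it lies below
  \<open>min (f (I, \<cdot>)) (f (I', \<cdot>))\<close>, which has probability \<open>(1 - d) / (1 + d)\<close> for \<open>d = d\<^sub>T\<^sub>V (A I) (A I')\<close>.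
  Concavity of \<open>2 * d / (1 + d)\<close> gives the bound on average.
\<close>

text \<open>The shared seed may not depend on the pair of inputs, so one point process has to serve
  all densities at once. Densities need not be bounded, hence heights run over all nonnegative reals
  and the process has infinite rate: its points cannot be listed in order of time. It is therefore
  cut into countably many independent layers of height one and rate one, each of them a sequence of
  i.i.d. marks and exponential gaps. The region below a density has area 1, and the first hits of
  its slices compete like independent exponential clocks whose rates add up. The ratio
  \<open>(1 - d) / (1 + d)\<close> is a ratio of areas: the minimum of the two densities has
  integral \<open>1 - d\<close>, the maximum \<open>1 + d\<close>. The other obstacle is
  measurability. Distances, disagreement events and densities must depend measurably on the inputs,
  although they come from a supremum, from the diagonal, or from an existence theorem for one input
  at a time. Each is reduced to countably many conditions through a countable family generating the
  sigma-algebra of \<open>N\<close>.\<close>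

subsection \<open>Total variation distance\<close>

primrec algebra_stage :: "'b set \<Rightarrow> 'b set set \<Rightarrow> nat \<Rightarrow> 'b set set" where
  "algebra_stage \<Omega> G 0 = insert {} G"
| "algebra_stage \<Omega> G (Suc n) = algebra_stage \<Omega> G n \<union> (\<lambda>a. \<Omega> - a) ` algebra_stage \<Omega> G n
     \<union> (\<lambda>(a, b). a \<union> b) ` (algebra_stage \<Omega> G n \<times> algebra_stage \<Omega> G n)"

text \<open>Closing under complements and binary unions in stages keeps every stage countable. An
  algebra is wanted because its members approximate all measurable sets in measure.\<close>

lemma ex_countable_generating_algebra:
  assumes "countable G" "G \<subseteq> Pow \<Omega>"
  shows "\<exists>\<C>. countable \<C> \<and> algebra \<Omega> \<C> \<and> sigma_sets \<Omega> \<C> = sigma_sets \<Omega> G"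
proof -
  let ?\<C> = "\<Union>n. algebra_stage \<Omega> G n"
  have cnt: "countable (algebra_stage \<Omega> G n)" for n
    by (induction n) (use assms(1) in auto)
  have sub: "algebra_stage \<Omega> G n \<subseteq> sigma_sets \<Omega> G" for n
    by (induction n) (auto intro: sigma_sets.intros sigma_sets_Un)
  have mono: "algebra_stage \<Omega> G n \<subseteq> algebra_stage \<Omega> G m" if "n \<le> m" for n m
    using that by (induction rule: dec_induct) auto
  have un: "a \<union> b \<in> ?\<C>" if a: "a \<in> algebra_stage \<Omega> G n" and b: "b \<in> algebra_stage \<Omega> G m" for a b n m
  proof -
    have "a \<in> algebra_stage \<Omega> G (max n m)" "b \<in> algebra_stage \<Omega> G (max n m)"
      using mono[of n "max n m"] mono[of m "max n m"] a b by auto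
    then have "a \<union> b \<in> algebra_stage \<Omega> G (Suc (max n m))" by auto
    then show ?thesis by blast
  qed
  have co: "\<Omega> - a \<in> ?\<C>" if a: "a \<in> algebra_stage \<Omega> G n" for a n
  proof -
    have "\<Omega> - a \<in> algebra_stage \<Omega> G (Suc n)" using a by auto
    then show ?thesis by blast
  qed
  have "G \<subseteq> algebra_stage \<Omega> G 0" "{} \<in> algebra_stage \<Omega> G 0" by auto
  then have G: "G \<subseteq> ?\<C>" "{} \<in> ?\<C>" by blast+
  have pow: "?\<C> \<subseteq> Pow \<Omega>"
    using sub sigma_sets_into_sp[OF assms(2)] by blast
  have "algebra \<Omega> ?\<C>"
    unfolding algebra_iff_Un
  proof (intro conjI ballI pow G(2))
    show "\<Omega> - a \<in> ?\<C>" if "a \<in> ?\<C>" for a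
      using that by (elim UN_E) (rule co)
    show "a \<union> b \<in> ?\<C>" if "a \<in> ?\<C>" "b \<in> ?\<C>" for a b
      using that by (elim UN_E) (rule un)
  qed
  moreover have "sigma_sets \<Omega> ?\<C> = sigma_sets \<Omega> G"
    using sub G(1) by (intro antisym sigma_sets_mono sigma_sets_mono' UN_least)
  moreover have "countable ?\<C>" using cnt by auto
  ultimately show ?thesis by blast
qed

text \<open>The approximable sets form a sigma-algebra. Two measures are treated at once because a
  difference such as \<open>measure P S - measure Q S\<close> needs the same \<open>B\<close> for
  both.\<close>

lemma measure_approx_algebra:
  assumes alg: "algebra (space N) \<C>" and gen: "sets N = sigma_sets (space N) \<C>"
    and P: "finite_measure P" "sets P = sets N" and Q: "finite_measure Q" "sets Q = sets N"
    and S: "S \<in> sets N" and e: "0 < e"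
  shows "\<exists>B\<in>\<C>. measure P ((S - B) \<union> (B - S)) < e \<and> measure Q ((S - B) \<union> (B - S)) < e"
proof -
  interpret alg: algebra "space N" \<C> by fact
  interpret P: finite_measure P by fact
  interpret Q: finite_measure Q by fact
  have CN: "B \<in> sets N" if "B \<in> \<C>" for B using that gen by auto
  note PQ[simp] = P(2) Q(2)
  from S[unfolded gen] e show ?thesis
  proof (induction arbitrary: e)
    case (Basic a)
    then show ?case by (intro bexI[of _ a]) auto
  next
    case Empty
    then show ?case by (intro bexI[of _ "{}"]) auto
  next
    case (Compl a)
    from Compl.IH[OF Compl.prems] obtain B where B: "B \<in> \<C>"
      "measure P ((a - B) \<union> (B - a)) < e" "measure Q ((a - B) \<union> (B - a)) < e" by blast
    have "((space N - a) - (space N - B)) \<union> ((space N - B) - (space N - a)) = (a - B) \<union> (B - a)"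
      using sets.sets_into_space[of a N] Compl.hyps CN[OF B(1)] gen sets.sets_into_space[of B N]
      by auto
    then show ?case using B by (intro bexI[of _ "space N - B"]) auto
  next
    case (Union a)
    have aN: "a i \<in> sets N" for i using Union.hyps gen by auto
    have tends: "(\<lambda>n. measure R (\<Union>i<n. a i)) \<longlonglongrightarrow> measure R (\<Union>i. a i)"
      if "finite_measure R" "sets R = sets N" for R
    proof -
      interpret R: finite_measure R by fact
      have "(\<lambda>n. measure R (\<Union>i<n. a i)) \<longlonglongrightarrow> measure R (\<Union>n. \<Union>i<n. a i)"
        using aN that by (intro R.finite_Lim_measure_incseq) (auto simp: incseq_def intro: less_le_trans)
      also have "(\<Union>n. \<Union>i<n. a i) = (\<Union>i. a i)" by auto
      finally show ?thesis .
    qed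
    \<comment> \<open>The union is cut at a finite \<open>n\<close> whose tail is below
      \<open>e / 2\<close> for both measures.\<close>
    have "\<forall>\<^sub>F n in sequentially. measure P (\<Union>i. a i) - measure P (\<Union>i<n. a i) < e / 2
       \<and> measure Q (\<Union>i. a i) - measure Q (\<Union>i<n. a i) < e / 2"
    proof (intro eventually_conj)
      show "\<forall>\<^sub>F n in sequentially. measure P (\<Union>i. a i) - measure P (\<Union>i<n. a i) < e / 2"
        using order_tendstoD(1)[OF tends[OF P], of "measure P (\<Union>i. a i) - e / 2"] Union.prems
        by (auto elim!: eventually_mono)
      show "\<forall>\<^sub>F n in sequentially. measure Q (\<Union>i. a i) - measure Q (\<Union>i<n. a i) < e / 2"
        using order_tendstoD(1)[OF tends[OF Q], of "measure Q (\<Union>i. a i) - e / 2"] Union.prems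
        by (auto elim!: eventually_mono)
    qed
    then obtain n where n: "measure P (\<Union>i. a i) - measure P (\<Union>i<n. a i) < e / 2"
      "measure Q (\<Union>i. a i) - measure Q (\<Union>i<n. a i) < e / 2"
      by (auto simp: eventually_sequentially)
    \<comment> \<open>The \<open>n\<close> sets share the remaining \<open>e / 2\<close>;
      \<open>n + 1\<close> keeps the share positive when \<open>n = 0\<close>.\<close>
    have "e / (2 * (real n + 1)) > 0" using Union.prems by auto
    then have "\<forall>i. \<exists>B\<in>\<C>. measure P ((a i - B) \<union> (B - a i)) < e / (2 * (real n + 1))
        \<and> measure Q ((a i - B) \<union> (B - a i)) < e / (2 * (real n + 1))"
      using Union.IH by blast
    then obtain B where BC: "\<And>i. B i \<in> \<C>"
      and BP: "\<And>i. measure P ((a i - B i) \<union> (B i - a i)) < e / (2 * (real n + 1))"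
      and BQ: "\<And>i. measure Q ((a i - B i) \<union> (B i - a i)) < e / (2 * (real n + 1))"
      by metis
    let ?B = "\<Union>i<n. B i"
    have BN: "B i \<in> sets N" for i using BC CN by auto
    have "?B \<in> \<C>" using BC by (intro alg.finite_UN) auto
    moreover have "measure R (((\<Union>i. a i) - ?B) \<union> (?B - (\<Union>i. a i))) < e"
      if R: "finite_measure R" "sets R = sets N"
        and n: "measure R (\<Union>i. a i) - measure R (\<Union>i<n. a i) < e / 2"
        and BR: "\<And>i. measure R ((a i - B i) \<union> (B i - a i)) < e / (2 * (real n + 1))" for R
    proof -
      interpret R: finite_measure R by fact
      have "measure R (((\<Union>i. a i) - ?B) \<union> (?B - (\<Union>i. a i)))
         \<le> measure R (((\<Union>i. a i) - (\<Union>i<n. a i)) \<union> (\<Union>i<n. (a i - B i) \<union> (B i - a i)))"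
        using aN BN R(2) by (intro R.finite_measure_mono) auto
      also have "\<dots> \<le> measure R ((\<Union>i. a i) - (\<Union>i<n. a i)) + measure R (\<Union>i<n. (a i - B i) \<union> (B i - a i))"
        using aN BN R(2) by (intro measure_Un_le) auto
      also have "measure R ((\<Union>i. a i) - (\<Union>i<n. a i)) = measure R (\<Union>i. a i) - measure R (\<Union>i<n. a i)"
        using aN R(2) by (intro R.finite_measure_Diff) auto
      also have "measure R (\<Union>i<n. (a i - B i) \<union> (B i - a i)) \<le> (\<Sum>i<n. measure R ((a i - B i) \<union> (B i - a i)))"
        using aN BN R(2) by (intro R.finite_measure_subadditive_finite) auto
      also have "\<dots> \<le> (\<Sum>i<n. e / (2 * (real n + 1)))"
        using BR by (intro sum_mono) (auto intro: less_imp_le)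
      also have "\<dots> = real n * e / (2 * (real n + 1))" by simp
      also have "\<dots> \<le> e / 2" using Union.prems by (simp add: field_simps)
      finally show ?thesis using n by simp
    qed
    ultimately show ?case using n BP BQ P Q by (intro bexI[of _ ?B]) blast+
  qed
qed

lemma (in finite_measure) abs_measure_diff_le:
  assumes "A \<in> sets M" "B \<in> sets M"
  shows "\<bar>measure M A - measure M B\<bar> \<le> measure M ((A - B) \<union> (B - A))"
proof -
  have "measure M A \<le> measure M (B \<union> ((A - B) \<union> (B - A)))"
    "measure M B \<le> measure M (A \<union> ((A - B) \<union> (B - A)))"
    using assms by (auto intro!: finite_measure_mono)
  moreover have "measure M (B \<union> ((A - B) \<union> (B - A))) \<le> measure M B + measure M ((A - B) \<union> (B - A))"
    "measure M (A \<union> ((A - B) \<union> (B - A))) \<le> measure M A + measure M ((A - B) \<union> (B - A))"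
    using assms by (auto intro!: measure_Un_le)
  ultimately show ?thesis by linarith
qed

section \<open>Total variation as a countable supremum\<close>

text \<open>A real \<open>SUP\<close> is meaningful only with an upper bound. The family of sets is
  arbitrary because both \<open>sets N\<close> and its generating algebra occur.\<close>

lemma tv_dist_bdd:
  assumes "prob_space P" "prob_space Q"
  shows "bdd_above ((\<lambda>S. \<bar>measure P S - measure Q S\<bar>) ` \<S>)"
proof (intro bdd_aboveI2[where M=1])
  fix S
  show "\<bar>measure P S - measure Q S\<bar> \<le> 1"
    using prob_space.prob_le_1[OF assms(1), of S] prob_space.prob_le_1[OF assms(2), of S]
    by (simp add: abs_le_iff add.commute add_increasing2 measure_nonneg diff_le_eq)
qed

lemma tv_dist_upper:
  assumes "prob_space P" "prob_space Q" "S \<in> sets N"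
  shows "measure P S - measure Q S \<le> tv_dist N P Q"
proof -
  have "\<bar>measure P S - measure Q S\<bar> \<le> tv_dist N P Q"
    unfolding tv_dist_def using assms by (intro cSUP_upper tv_dist_bdd)
  then show ?thesis by simp
qed

text \<open>Replacing \<open>S\<close> by one \<open>B\<close> that is close in both measures
  changes the difference by less than any \<open>e\<close>. For a countable algebra the supremum
  becomes countable, which makes the distance measurable in its arguments.\<close>

lemma tv_dist_algebra:
  assumes alg: "algebra (space N) \<C>" and gen: "sets N = sigma_sets (space N) \<C>"
    and P: "prob_space P" "sets P = sets N" and Q: "prob_space Q" "sets Q = sets N"
  shows "tv_dist N P Q = (SUP S\<in>\<C>. \<bar>measure P S - measure Q S\<bar>)"
  unfolding tv_dist_def
proof (rule antisym)
  interpret alg: algebra "space N" \<C> by fact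
  interpret P: prob_space P by fact
  interpret Q: prob_space Q by fact
  have CN: "\<C> \<subseteq> sets N" using gen by auto
  show "(SUP S\<in>\<C>. \<bar>measure P S - measure Q S\<bar>) \<le> (SUP S\<in>sets N. \<bar>measure P S - measure Q S\<bar>)"
    using CN alg.empty_sets by (intro cSUP_subset_mono tv_dist_bdd P Q) auto
  show "(SUP S\<in>sets N. \<bar>measure P S - measure Q S\<bar>) \<le> (SUP S\<in>\<C>. \<bar>measure P S - measure Q S\<bar>)"
  proof (rule cSUP_least)
    fix S assume S: "S \<in> sets N"
    show "\<bar>measure P S - measure Q S\<bar> \<le> (SUP S\<in>\<C>. \<bar>measure P S - measure Q S\<bar>)"
    proof (rule field_le_epsilon)
      fix e :: real assume e: "0 < e"
      obtain B where B: "B \<in> \<C>" "measure P ((S - B) \<union> (B - S)) < e / 2"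
        "measure Q ((S - B) \<union> (B - S)) < e / 2"
        using measure_approx_algebra[OF alg gen P.finite_measure_axioms P(2) Q.finite_measure_axioms Q(2) S, of "e/2"] e
        by auto
      have "\<bar>measure P S - measure P B\<bar> < e / 2" "\<bar>measure Q S - measure Q B\<bar> < e / 2"
        using P.abs_measure_diff_le[of S B] Q.abs_measure_diff_le[of S B] B S CN P(2) Q(2) by auto
      moreover have "\<bar>measure P B - measure Q B\<bar> \<le> (SUP S\<in>\<C>. \<bar>measure P S - measure Q S\<bar>)"
        using B by (intro cSUP_upper tv_dist_bdd P Q) auto
      ultimately show "\<bar>measure P S - measure Q S\<bar> \<le> (SUP S\<in>\<C>. \<bar>measure P S - measure Q S\<bar>) + e"
        by linarith
    qed
  qed auto
qed

lemma measurable_measure_kernel: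
  assumes "A \<in> M \<rightarrow>\<^sub>M prob_algebra N" "S \<in> sets N"
  shows "(\<lambda>x. measure (A x) S) \<in> borel_measurable M"
  using assms by (intro measurable_compose[OF measurable_prob_algebraD[OF assms(1)]] measurable_measure_subprob_algebra)

lemma kernel_space:
  assumes "A \<in> M \<rightarrow>\<^sub>M prob_algebra N" "x \<in> space M"
  shows "prob_space (A x)" "sets (A x) = sets N" "space (A x) = space N"
  using measurable_space[OF assms] by (auto simp: space_prob_algebra dest: sets_eq_imp_space_eq)

lemma separated_countably_generatedD:
  assumes "separated_countably_generated N"
  shows "\<exists>\<C>. countable \<C> \<and> algebra (space N) \<C> \<and> sets N = sigma_sets (space N) \<C>"
proof -
  obtain G where "countable G" "G \<subseteq> Pow (space N)" "sets N = sigma_sets (space N) G"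
    using assms unfolding separated_countably_generated_def by auto
  then show ?thesis
    using ex_countable_generating_algebra[of G "space N"] by (simp add: eq_commute)
qed

lemma tv_dist_measurable:
  assumes N: "separated_countably_generated N" and A: "A \<in> M \<rightarrow>\<^sub>M prob_algebra N"
  shows "(\<lambda>(I, I'). tv_dist N (A I) (A I')) \<in> borel_measurable (M \<Otimes>\<^sub>M M)"
proof -
  from separated_countably_generatedD[OF N] obtain \<C>
    where \<C>: "countable \<C>" "algebra (space N) \<C>" "sets N = sigma_sets (space N) \<C>" by blast
  have [measurable]: "(\<lambda>x. measure (A x) S) \<in> borel_measurable M" if "S \<in> \<C>" for S
    using measurable_measure_kernel[OF A] \<C>(3) that by auto
  have "(\<lambda>x. SUP S\<in>\<C>. \<bar>measure (A (fst x)) S - measure (A (snd x)) S\<bar>) \<in> borel_measurable (M \<Otimes>\<^sub>M M)"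
    using \<C>(1) kernel_space[OF A] by (intro borel_measurable_cSUP tv_dist_bdd) (auto simp: space_pair_measure)
  also have "?this \<longleftrightarrow> ?thesis"
    using kernel_space[OF A]
    by (intro measurable_cong) (auto simp: space_pair_measure tv_dist_algebra[OF \<C>(2,3)])
  finally show ?thesis .
qed

section \<open>Disagreement of coupled variables\<close>

text \<open>Points that no set of the countable generator separates are separated by no measurable
  set, hence are equal. So disagreement is a countable disjunction of measurable conditions.\<close>

lemma pred_neq_measurable:
  assumes N: "separated_countably_generated N"
    and f[measurable]: "f \<in> K \<rightarrow>\<^sub>M N" and g[measurable]: "g \<in> K \<rightarrow>\<^sub>M N"
  shows "Measurable.pred K (\<lambda>x. f x \<noteq> g x)"
proof -
  obtain G where G: "countable G" "G \<subseteq> Pow (space N)" "sets N = sigma_sets (space N) G"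
    using N unfolding separated_countably_generated_def by auto
  have [measurable]: "S \<in> sets N" if "S \<in> G" for S using that G by auto
  have N': "\<forall>x\<in>space N. \<forall>y\<in>space N. x \<noteq> y \<longrightarrow> (\<exists>S\<in>sets N. x \<in> S \<and> y \<notin> S)"
    using N unfolding separated_countably_generated_def by (rule conjunct2)
  have sep: "x = y" if "x \<in> space N" "y \<in> space N" and eq: "\<forall>S\<in>G. x \<in> S \<longleftrightarrow> y \<in> S" for x y
  proof -
    have "x \<in> S \<longleftrightarrow> y \<in> S" if "S \<in> sigma_sets (space N) G" for S
      using that by (induction) (use eq \<open>x \<in> space N\<close> \<open>y \<in> space N\<close> in auto)
    then have "\<not> (\<exists>S\<in>sets N. x \<in> S \<and> y \<notin> S)" using G(3) by simp
    then show ?thesis using N' that(1,2) by metis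
  qed
  have "Measurable.pred K (\<lambda>x. \<exists>S\<in>G. \<not> (f x \<in> S \<longleftrightarrow> g x \<in> S))"
    using G(1) by measurable
  also have "?this \<longleftrightarrow> ?thesis"
    using sep measurable_space[OF f] measurable_space[OF g] by (intro measurable_cong) metis
  finally show ?thesis .
qed

text \<open>The preimages of \<open>S\<close> under \<open>f\<close> and \<open>g\<close> can differ
  only inside the disagreement event.\<close>

lemma tv_dist_le_prob_neq:
  assumes R: "prob_space R" and f[measurable]: "f \<in> R \<rightarrow>\<^sub>M N" and g[measurable]: "g \<in> R \<rightarrow>\<^sub>M N"
    and [measurable]: "Measurable.pred R (\<lambda>r. f r \<noteq> g r)"
  shows "tv_dist N (distr R N f) (distr R N g) \<le> measure R {r\<in>space R. f r \<noteq> g r}"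
  unfolding tv_dist_def
proof (rule cSUP_least)
  interpret R: prob_space R by fact
  fix S assume [measurable]: "S \<in> sets N"
  have "\<bar>measure (distr R N f) S - measure (distr R N g) S\<bar>
     = \<bar>measure R (f -` S \<inter> space R) - measure R (g -` S \<inter> space R)\<bar>"
    by (simp add: measure_distr)
  also have "\<dots> \<le> measure R ((f -` S \<inter> space R - g -` S \<inter> space R) \<union> (g -` S \<inter> space R - f -` S \<inter> space R))"
    by (intro R.abs_measure_diff_le) auto
  also have "\<dots> \<le> measure R {r\<in>space R. f r \<noteq> g r}"
    by (intro R.finite_measure_mono) auto
  finally show "\<bar>measure (distr R N f) S - measure (distr R N g) S\<bar> \<le> measure R {r\<in>space R. f r \<noteq> g r}" .
qed auto

lemma tv_dist_nonneg_le_1: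
  assumes "prob_space P" "prob_space Q"
  shows "0 \<le> tv_dist N P Q" "tv_dist N P Q \<le> 1"
proof -
  show "0 \<le> tv_dist N P Q"
    using tv_dist_upper[OF assms, of "{}" N] by simp
  show "tv_dist N P Q \<le> 1"
    unfolding tv_dist_def
  proof (rule cSUP_least)
    fix S
    show "\<bar>measure P S - measure Q S\<bar> \<le> 1"
      using prob_space.prob_le_1[OF assms(1), of S] prob_space.prob_le_1[OF assms(2), of S]
      by (simp add: abs_le_iff add.commute add_increasing2 measure_nonneg diff_le_eq)
  qed auto
qed

lemma integrable_tv_dist:
  assumes N: "separated_countably_generated N" and A: "A \<in> M \<rightarrow>\<^sub>M prob_algebra N"
    and \<mu>: "\<mu> \<in> space (prob_algebra M)"
  shows "integrable (\<mu> \<Otimes>\<^sub>M \<mu>) (\<lambda>(I, I'). tv_dist N (A I) (A I'))"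
proof -
  interpret \<mu>: prob_space \<mu> using \<mu> by (simp add: space_prob_algebra)
  have [measurable_cong]: "sets \<mu> = sets M" using \<mu> by (simp add: space_prob_algebra)
  then have sp: "space \<mu> = space M" by (rule sets_eq_imp_space_eq)
  interpret pair_prob_space \<mu> \<mu> ..
  have [measurable]: "(\<lambda>(I, I'). tv_dist N (A I) (A I')) \<in> borel_measurable (\<mu> \<Otimes>\<^sub>M \<mu>)"
    using tv_dist_measurable[OF N A] by measurable
  show ?thesis
    using tv_dist_nonneg_le_1[OF kernel_space(1)[OF A] kernel_space(1)[OF A]]
    by (intro P.integrable_const_bound[where B=1] AE_I2) (auto simp: space_pair_measure sp)
qed

section \<open>From replicability to indistinguishability\<close>

lemma replicable_iff:
  "replicable M R F \<rho> \<longleftrightarrow>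
     (\<forall>\<mu>\<in>space (prob_algebra M).
        {x \<in> space ((\<mu> \<Otimes>\<^sub>M \<mu>) \<Otimes>\<^sub>M R). F (fst (fst x)) (snd x) \<noteq> F (snd (fst x)) (snd x)}
          \<in> sets ((\<mu> \<Otimes>\<^sub>M \<mu>) \<Otimes>\<^sub>M R) \<and>
        measure ((\<mu> \<Otimes>\<^sub>M \<mu>) \<Otimes>\<^sub>M R)
          {x \<in> space ((\<mu> \<Otimes>\<^sub>M \<mu>) \<Otimes>\<^sub>M R). F (fst (fst x)) (snd x) \<noteq> F (snd (fst x)) (snd x)} \<le> \<rho>)"
proof -
  have "{((I, I'), r). ((I, I'), r) \<in> \<Omega> \<and> F I r \<noteq> F I' r}
      = {x \<in> \<Omega>. F (fst (fst x)) (snd x) \<noteq> F (snd (fst x)) (snd x)}" for \<Omega>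
    by auto
  then show ?thesis
    by (simp add: replicable_def pred_def case_prod_unfold)
qed

text \<open>By Tonelli's theorem the probability of disagreement is the average over
  \<open>(I, I')\<close> of the probability for fixed inputs, and each of these dominates the
  distance.\<close>

lemma replicable_imp_tv_indistinguishable:
  assumes N: "separated_countably_generated N" and A: "learning_rule M N A"
    and imp: "implements M N R F A" and rep: "replicable M R F \<rho>"
  shows "tv_indistinguishable M N A \<rho>"
  unfolding tv_indistinguishable_def
proof (intro ballI conjI)
  have A': "A \<in> M \<rightarrow>\<^sub>M prob_algebra N" using A by (simp add: learning_rule_def)
  fix \<mu> assume \<mu>: "\<mu> \<in> space (prob_algebra M)"
  show int: "integrable (\<mu> \<Otimes>\<^sub>M \<mu>) (\<lambda>(I, I'). tv_dist N (A I) (A I'))"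
    by (rule integrable_tv_dist[OF N A' \<mu>])
  interpret \<mu>: prob_space \<mu> using \<mu> by (simp add: space_prob_algebra)
  have [measurable_cong]: "sets \<mu> = sets M" using \<mu> by (simp add: space_prob_algebra)
  then have sp: "space \<mu> = space M" by (rule sets_eq_imp_space_eq)
  interpret \<mu>2: pair_prob_space \<mu> \<mu> ..
  interpret R: prob_space R using imp by (simp add: implements_def)
  interpret W: pair_prob_space "\<mu> \<Otimes>\<^sub>M \<mu>" R ..
  let ?E = "{x \<in> space ((\<mu> \<Otimes>\<^sub>M \<mu>) \<Otimes>\<^sub>M R). F (fst (fst x)) (snd x) \<noteq> F (snd (fst x)) (snd x)}"
  have E: "?E \<in> sets ((\<mu> \<Otimes>\<^sub>M \<mu>) \<Otimes>\<^sub>M R)" and le: "measure ((\<mu> \<Otimes>\<^sub>M \<mu>) \<Otimes>\<^sub>M R) ?E \<le> \<rho>"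
    using rep \<mu> unfolding replicable_iff by blast+
  have F: "(\<lambda>(I, r). F I r) \<in> M \<Otimes>\<^sub>M R \<rightarrow>\<^sub>M N" using imp by (simp add: implements_def)
  have Fm: "F I \<in> R \<rightarrow>\<^sub>M N" if "I \<in> space M" for I
    using measurable_Pair2[OF F that] by simp
  have tv: "tv_dist N (A I) (A I') \<le> measure R {r\<in>space R. F I r \<noteq> F I' r}"
    if "I \<in> space M" "I' \<in> space M" for I I'
    using tv_dist_le_prob_neq[OF R.prob_space_axioms Fm[OF that(1)] Fm[OF that(2)]
        pred_neq_measurable[OF N Fm[OF that(1)] Fm[OF that(2)]]] imp that
    by (simp add: implements_def)
  have "ennreal (\<integral>x. (case x of (I, I') \<Rightarrow> tv_dist N (A I) (A I')) \<partial>(\<mu> \<Otimes>\<^sub>M \<mu>))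
     = (\<integral>\<^sup>+x. ennreal (case x of (I, I') \<Rightarrow> tv_dist N (A I) (A I')) \<partial>(\<mu> \<Otimes>\<^sub>M \<mu>))"
    using tv_dist_nonneg_le_1(1) kernel_space[OF A']
    by (intro nn_integral_eq_integral[symmetric] int AE_I2) (auto simp: space_pair_measure sp)
  also have "\<dots> \<le> (\<integral>\<^sup>+x. emeasure R (Pair x -` ?E) \<partial>(\<mu> \<Otimes>\<^sub>M \<mu>))"
  proof (rule nn_integral_mono)
    fix x assume "x \<in> space (\<mu> \<Otimes>\<^sub>M \<mu>)"
    then obtain I I' where x: "x = (I, I')" "I \<in> space M" "I' \<in> space M"
      by (auto simp: space_pair_measure sp)
    have "Pair x -` ?E = {r\<in>space R. F I r \<noteq> F I' r}"
      using x by (auto simp: space_pair_measure sp)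
    then show "ennreal (case x of (I, I') \<Rightarrow> tv_dist N (A I) (A I')) \<le> emeasure R (Pair x -` ?E)"
      using tv[OF x(2,3)] x(1) by (simp add: R.emeasure_eq_measure ennreal_leI)
  qed
  also have "\<dots> = ennreal (measure ((\<mu> \<Otimes>\<^sub>M \<mu>) \<Otimes>\<^sub>M R) ?E)"
    using R.emeasure_pair_measure_alt[OF E] by (simp only: W.P.emeasure_eq_measure)
  finally show "(\<integral>(I, I'). tv_dist N (A I) (A I') \<partial>(\<mu> \<Otimes>\<^sub>M \<mu>)) \<le> \<rho>"
    using le by (simp only: ennreal_le_iff measure_nonneg)
qed

subsection \<open>Jointly measurable densities\<close>

lemma measure_density_eq_integral:
  fixes f :: "'b \<Rightarrow> real"
  assumes [measurable]: "f \<in> borel_measurable M" "B \<in> sets M" and "\<And>x. 0 \<le> f x"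
  shows "measure (density M (\<lambda>x. ennreal (f x))) B = (\<integral>x. f x * indicator B x \<partial>M)"
proof -
  have "(\<integral>x. f x * indicator B x \<partial>M) = enn2real (\<integral>\<^sup>+x. ennreal (f x * indicator B x) \<partial>M)"
    using assms(3) by (intro integral_eq_nn_integral) auto
  also have "(\<integral>\<^sup>+x. ennreal (f x * indicator B x) \<partial>M) = emeasure (density M (\<lambda>x. ennreal (f x))) B"
    using assms(3) by (auto simp: emeasure_density ennreal_mult intro!: nn_integral_cong split: split_indicator)
  finally show ?thesis by (simp add: measure_def)
qed

section \<open>L1 norms and L1 separability over a countable algebra\<close>

text \<open>A bound on the integrals of \<open>h\<close> over the algebra passes to all measurable
  sets, by approximation under the measure with density \<open>\<bar>h\<bar>\<close>. Testing on the
  positive and on the nonpositive set of \<open>h\<close> then costs \<open>c\<close> each.\<close>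

lemma integral_abs_le_algebra:
  fixes h :: "'b \<Rightarrow> real"
  assumes M: "finite_measure M" and alg: "algebra (space M) \<C>" and gen: "sets M = sigma_sets (space M) \<C>"
    and h: "integrable M h" and le: "\<And>B. B \<in> \<C> \<Longrightarrow> \<bar>\<integral>x. h x * indicator B x \<partial>M\<bar> \<le> c"
  shows "(\<integral>x. \<bar>h x\<bar> \<partial>M) \<le> 2 * c"
proof -
  interpret finite_measure M by fact
  have [measurable]: "h \<in> borel_measurable M" using h by auto
  let ?R = "density M (\<lambda>x. ennreal \<bar>h x\<bar>)"
  have "emeasure ?R (space ?R) = ennreal (\<integral>x. \<bar>h x\<bar> \<partial>M)"
    using h by (simp add: emeasure_density nn_integral_eq_integral cong: nn_integral_cong)
  then have R: "finite_measure ?R" by (intro finite_measureI) simp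
  have hB: "integrable M (\<lambda>x. h x * indicator B x)" if "B \<in> sets M" for B
    using integrable_real_mult_indicator[OF that h] .
  have CM: "B \<in> sets M" if "B \<in> \<C>" for B using that gen by auto
  have le': "\<bar>\<integral>x. h x * indicator S x \<partial>M\<bar> \<le> c" if S: "S \<in> sets M" for S
  proof (rule field_le_epsilon)
    fix e :: real assume "0 < e"
    then obtain B where B: "B \<in> \<C>" "measure ?R ((S - B) \<union> (B - S)) < e"
      using measure_approx_algebra[OF alg gen finite_measure_axioms refl R _ S] by auto
    note [measurable] = S CM[OF B(1)]
    have "\<bar>(\<integral>x. h x * indicator S x \<partial>M) - (\<integral>x. h x * indicator B x \<partial>M)\<bar>
      = \<bar>\<integral>x. h x * indicator S x - h x * indicator B x \<partial>M\<bar>"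
      using hB[OF S] hB[OF CM[OF B(1)]] by simp
    also have "\<dots> \<le> (\<integral>x. \<bar>h x * indicator S x - h x * indicator B x\<bar> \<partial>M)"
      by (rule integral_abs_bound)
    also have "\<dots> = (\<integral>x. \<bar>h x\<bar> * indicator ((S - B) \<union> (B - S)) x \<partial>M)"
      by (intro Bochner_Integration.integral_cong) (auto simp: indicator_def)
    also have "\<dots> = measure ?R ((S - B) \<union> (B - S))"
      by (intro measure_density_eq_integral[symmetric]) auto
    finally show "\<bar>\<integral>x. h x * indicator S x \<partial>M\<bar> \<le> c + e"
      using B le[OF B(1)] by linarith
  qed
  let ?S = "{x \<in> space M. 0 < h x}" and ?T = "{x \<in> space M. h x \<le> 0}"
  have "(\<integral>x. \<bar>h x\<bar> \<partial>M) = (\<integral>x. h x * indicator ?S x - h x * indicator ?T x \<partial>M)"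
    by (intro Bochner_Integration.integral_cong) (auto simp: indicator_def)
  also have "\<dots> = (\<integral>x. h x * indicator ?S x \<partial>M) - (\<integral>x. h x * indicator ?T x \<partial>M)"
    by (intro Bochner_Integration.integral_diff hB) auto
  also have "\<dots> \<le> 2 * c"
    using le'[of ?S] le'[of ?T] by auto
  finally show ?thesis .
qed

text \<open>The dense family consists of finite rational combinations of indicators of sets in the
  algebra; coding them by lists makes countability immediate. Density is an induction over
  indicators, sums and dominated limits.\<close>

lemma L1_separable:
  fixes M :: "'b measure"
  assumes M: "finite_measure M" and cnt: "countable \<C>" and alg: "algebra (space M) \<C>"
    and gen: "sets M = sigma_sets (space M) \<C>"
  shows "\<exists>s :: nat \<Rightarrow> 'b \<Rightarrow> real. (\<forall>n. integrable M (s n)) \<and>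
    (\<forall>g e. integrable M g \<longrightarrow> 0 < e \<longrightarrow> (\<exists>n. (\<integral>x. \<bar>g x - s n x\<bar> \<partial>M) < e))"
proof -
  interpret finite_measure M by fact
  have CM[measurable]: "B \<in> sets M" if "B \<in> \<C>" for B using that gen by auto
  have ind: "integrable M (\<lambda>x. indicat_real B x)" if "B \<in> sets M" for B
    using that by (intro integrable_real_indicator) (auto simp: emeasure_eq_measure)
  define comb :: "(rat \<times> 'b set) list \<Rightarrow> 'b \<Rightarrow> real"
    where "comb l x = (\<Sum>(q, B)\<leftarrow>l. of_rat q * indicator B x)" for l x
  have comb_simps: "comb [] x = 0" "comb ((q, B) # l) x = of_rat q * indicator B x + comb l x"
    "comb (l @ l') x = comb l x + comb l' x" for q B l l' x
    by (simp_all add: comb_def)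
  let ?L = "lists ((UNIV :: rat set) \<times> \<C>)"
  have int: "integrable M (comb l)" if "l \<in> ?L" for l
    using that
  proof (induction l)
    case Nil
    then show ?case by (simp add: comb_simps cong: integrable_cong)
  next
    case (Cons p l)
    obtain q B where p: "p = (q, B)" by (cases p)
    have "integrable M (\<lambda>x. of_rat q * indicator B x + comb l x)"
      using Cons ind[OF CM, of B] p by (intro Bochner_Integration.integrable_add) auto
    then show ?case by (simp add: p comb_simps cong: integrable_cong)
  qed
  have dense: "\<forall>e>0. \<exists>l\<in>?L. (\<integral>x. \<bar>g x - comb l x\<bar> \<partial>M) < e" if "integrable M g" for g
    using that
  proof (induction rule: integrable_induct)
    case (base A c)
    note A[measurable] = base(1)
    show ?case
    proof (intro allI impI)
      fix e :: real assume e: "0 < e"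
      let ?m = "measure M (space M)"
      \<comment> \<open>Used for both error terms, with \<open>?m\<close> and with
        \<open>\<bar>r\<bar>\<close>; dividing by \<open>m + 1\<close> covers the value 0 and keeps
        the bound strict.\<close>
      have aux: "e / (2 * (m + 1)) * m < e / 2" if "0 \<le> m" for m :: real
      proof -
        have "m / (m + 1) < 1" using that by simp
        then have "e / 2 * (m / (m + 1)) < e / 2 * 1" using e by (intro mult_strict_left_mono) auto
        also have "e / 2 * (m / (m + 1)) = e / (2 * (m + 1)) * m"
          by (metis times_divide_times_eq times_divide_eq_left)
        finally show ?thesis by simp
      qed
      have "0 < e / (2 * (?m + 1))" using e by (simp add: add_nonneg_pos)
      \<comment> \<open>As \<open>c < r\<close>, the error is at most \<open>r - c\<close> where
        \<open>A\<close> and \<open>B\<close> overlap, and at most \<open>\<bar>r\<bar>\<close> more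
        where they differ.\<close>
      then obtain q where q: "c < of_rat q" "of_rat q < c + e / (2 * (?m + 1))"
        using of_rat_dense[of c "c + e / (2 * (?m + 1))"] by auto
      define r where "r = real_of_rat q"
      have "0 < e / (2 * (\<bar>r\<bar> + 1))" using e by (simp add: add_nonneg_pos)
      then obtain B where B: "B \<in> \<C>" "measure M ((A - B) \<union> (B - A)) < e / (2 * (\<bar>r\<bar> + 1))"
        using measure_approx_algebra[OF alg gen M refl M refl A] by auto
      note [measurable] = CM[OF B(1)]
      have comb: "comb [(q, B)] x = r * indicator B x" for x by (simp add: comb_simps r_def)
      have "(\<integral>x. \<bar>indicator A x *\<^sub>R c - comb [(q, B)] x\<bar> \<partial>M)
        \<le> (\<integral>x. (r - c) + \<bar>r\<bar> * indicator ((A - B) \<union> (B - A)) x \<partial>M)"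
      proof (rule integral_mono)
        show "integrable M (\<lambda>x. \<bar>indicator A x *\<^sub>R c - comb [(q, B)] x\<bar>)"
          unfolding comb using ind[OF A] ind[of B] by simp
        show "integrable M (\<lambda>x. (r - c) + \<bar>r\<bar> * indicator ((A - B) \<union> (B - A)) x)"
          by (intro Bochner_Integration.integrable_add integrable_mult_right ind) auto
        show "\<bar>indicator A x *\<^sub>R c - comb [(q, B)] x\<bar> \<le> (r - c) + \<bar>r\<bar> * indicator ((A - B) \<union> (B - A)) x" for x
          using q(1) unfolding comb r_def[symmetric] by (auto simp: indicator_def)
      qed
      also have "\<dots> = (r - c) * ?m + \<bar>r\<bar> * measure M ((A - B) \<union> (B - A))"
        using ind[of "(A - B) \<union> (B - A)"] by (subst Bochner_Integration.integral_add) (auto simp: mult.commute)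
      also have "(r - c) * ?m \<le> e / (2 * (?m + 1)) * ?m"
        using q(2) unfolding r_def by (intro mult_right_mono) auto
      also have "\<dots> \<le> e / 2" using aux[of ?m] by simp
      also have "\<bar>r\<bar> * measure M ((A - B) \<union> (B - A)) \<le> \<bar>r\<bar> * (e / (2 * (\<bar>r\<bar> + 1)))"
        using B(2) by (intro mult_left_mono) auto
      also have "\<dots> < e / 2" using aux[of "\<bar>r\<bar>"] by (simp add: mult.commute)
      finally have "(\<integral>x. \<bar>indicator A x *\<^sub>R c - comb [(q, B)] x\<bar> \<partial>M) < e" by simp
      then show "\<exists>l\<in>?L. (\<integral>x. \<bar>indicator A x *\<^sub>R c - comb l x\<bar> \<partial>M) < e"
        using B(1) by (intro bexI[of _ "[(q, B)]"]) auto
    qed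
  next
    case (add f g)
    show ?case
    proof (intro allI impI)
      fix e :: real assume "0 < e"
      then have "0 < e / 2" by simp
      then obtain l l' where l: "l \<in> ?L" "(\<integral>x. \<bar>f x - comb l x\<bar> \<partial>M) < e / 2"
        and l': "l' \<in> ?L" "(\<integral>x. \<bar>g x - comb l' x\<bar> \<partial>M) < e / 2"
        using add.IH by blast
      have "(\<integral>x. \<bar>(f x + g x) - comb (l @ l') x\<bar> \<partial>M)
        \<le> (\<integral>x. \<bar>f x - comb l x\<bar> + \<bar>g x - comb l' x\<bar> \<partial>M)"
        using add.hyps int[OF l(1)] int[OF l'(1)] by (intro integral_mono) (auto simp: comb_simps)
      also have "\<dots> = (\<integral>x. \<bar>f x - comb l x\<bar> \<partial>M) + (\<integral>x. \<bar>g x - comb l' x\<bar> \<partial>M)"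
        using add.hyps int[OF l(1)] int[OF l'(1)] by (intro Bochner_Integration.integral_add) auto
      finally have "(\<integral>x. \<bar>(f x + g x) - comb (l @ l') x\<bar> \<partial>M) < e"
        using l(2) l'(2) by linarith
      then show "\<exists>l\<in>?L. (\<integral>x. \<bar>(f x + g x) - comb l x\<bar> \<partial>M) < e"
        using l(1) l'(1) by (intro bexI[of _ "l @ l'"]) auto
    qed
  next
    case (lim f s)
    have [measurable]: "f \<in> borel_measurable M" "\<And>i. s i \<in> borel_measurable M"
      using lim.hyps by auto
    \<comment> \<open>The induction rule supplies \<open>norm (s i x) \<le> 2 * norm (f x)\<close>;
      adding \<open>f\<close> itself gives the 3.\<close>
    have "(\<lambda>i. \<integral>x. \<bar>f x - s i x\<bar> \<partial>M) \<longlonglongrightarrow> (\<integral>x. 0 \<partial>M)"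
    proof (rule integral_dominated_convergence[where w="\<lambda>x. 3 * norm (f x)"])
      show "AE x in M. (\<lambda>i. \<bar>f x - s i x\<bar>) \<longlonglongrightarrow> 0"
      proof (rule AE_I2)
        fix x assume "x \<in> space M"
        then have "(\<lambda>i. f x - s i x) \<longlonglongrightarrow> f x - f x"
          using lim.hyps(2) by (intro tendsto_diff tendsto_const) auto
        then show "(\<lambda>i. \<bar>f x - s i x\<bar>) \<longlonglongrightarrow> 0"
          by (intro tendsto_rabs_zero) simp
      qed
      show "AE x in M. norm \<bar>f x - s i x\<bar> \<le> 3 * norm (f x)" for i
        using lim.hyps(3) by (intro AE_I2) (smt (verit) real_norm_def)
    qed (use lim.hyps in auto)
    then have lim0: "(\<lambda>i. \<integral>x. \<bar>f x - s i x\<bar> \<partial>M) \<longlonglongrightarrow> 0" by simp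
    show ?case
    proof (intro allI impI)
      fix e :: real assume "0 < e"
      then have e: "0 < e / 2" by simp
      obtain i where i: "(\<integral>x. \<bar>f x - s i x\<bar> \<partial>M) < e / 2"
        using order_tendstoD(2)[OF lim0 e] by (auto simp: eventually_sequentially)
      obtain l where l: "l \<in> ?L" "(\<integral>x. \<bar>s i x - comb l x\<bar> \<partial>M) < e / 2"
        using lim.IH e by blast
      have "(\<integral>x. \<bar>f x - comb l x\<bar> \<partial>M) \<le> (\<integral>x. \<bar>f x - s i x\<bar> + \<bar>s i x - comb l x\<bar> \<partial>M)"
        using lim.hyps int[OF l(1)] by (intro integral_mono) auto
      also have "\<dots> = (\<integral>x. \<bar>f x - s i x\<bar> \<partial>M) + (\<integral>x. \<bar>s i x - comb l x\<bar> \<partial>M)"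
        using lim.hyps int[OF l(1)] by (intro Bochner_Integration.integral_add) auto
      finally show "\<exists>l\<in>?L. (\<integral>x. \<bar>f x - comb l x\<bar> \<partial>M) < e"
        using i l by (intro bexI[of _ l]) auto
    qed
  qed
  have L: "countable ?L" "?L \<noteq> {}" using cnt by auto
  show ?thesis
  proof (intro exI[of _ "\<lambda>n. comb (from_nat_into ?L n)"] conjI allI impI)
    show "integrable M (comb (from_nat_into ?L n))" for n
      using from_nat_into[OF L(2)] by (rule int)
    fix g :: "'b \<Rightarrow> real" and e :: real assume "integrable M g" "0 < e"
    then obtain l where l: "l \<in> ?L" "(\<integral>x. \<bar>g x - comb l x\<bar> \<partial>M) < e" using dense by blast
    then show "\<exists>n. (\<integral>x. \<bar>g x - comb (from_nat_into ?L n) x\<bar> \<partial>M) < e"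
      using from_nat_into_surj[OF L(1) l(1)] by auto
  qed
qed

section \<open>Measurable choice of a density\<close>

text \<open>The geometric rate makes the sum of all errors integrable, hence finite almost
  everywhere, so its terms tend to 0. L1 convergence without a rate gives this only along a
  subsequence. The factor 2 is that of \<open>integral_abs_le_algebra\<close>.\<close>

lemma AE_tendsto_of_L1_geometric:
  fixes h :: "nat \<Rightarrow> 'b \<Rightarrow> real" and D :: "'b \<Rightarrow> real"
  assumes int: "\<And>k. integrable M (h k)" "integrable M D"
    and le: "\<And>k. (\<integral>x. \<bar>h k x - D x\<bar> \<partial>M) \<le> 2 * (1 / 2) ^ k"
  shows "AE x in M. (\<lambda>k. h k x) \<longlonglongrightarrow> D x"
proof -
  have [measurable]: "h k \<in> borel_measurable M" "D \<in> borel_measurable M" for k using int by auto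
  have "(\<integral>\<^sup>+x. (\<Sum>k. ennreal \<bar>h k x - D x\<bar>) \<partial>M) = (\<Sum>k. \<integral>\<^sup>+x. ennreal \<bar>h k x - D x\<bar> \<partial>M)"
    by (intro nn_integral_suminf) auto
  also have "\<dots> = (\<Sum>k. ennreal (\<integral>x. \<bar>h k x - D x\<bar> \<partial>M))"
    using int by (intro suminf_cong nn_integral_eq_integral) auto
  also have "\<dots> \<le> (\<Sum>k. ennreal (2 * (1 / 2) ^ k))"
    using le by (intro suminf_le ennreal_leI) auto
  also have "\<dots> = ennreal (2 * (1 / (1 - 1 / 2)))"
    by (intro suminf_ennreal_eq sums_mult geometric_sums) auto
  also have "\<dots> < top" by simp
  finally have "AE x in M. (\<Sum>k. ennreal \<bar>h k x - D x\<bar>) \<noteq> \<infinity>"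
    by (intro nn_integral_PInf_AE) auto
  then show ?thesis
  proof eventually_elim
    case (elim x)
    then have "summable (\<lambda>k. \<bar>h k x - D x\<bar>)"
      by (intro summable_suminf_not_top) auto
    then have "(\<lambda>k. \<bar>h k x - D x\<bar>) \<longlonglongrightarrow> 0" by (rule summable_LIMSEQ_zero)
    then show ?case by (simp add: tendsto_rabs_zero_iff LIM_zero_iff)
  qed
qed

text \<open>\<open>RN_deriv\<close> has extended values but is finite almost everywhere here;
  \<open>enn2real\<close> alters it on a null set only and makes it real and nonnegative
  everywhere.\<close>

lemma ex_real_density:
  assumes P: "finite_measure P" and Q: "finite_measure Q" and sets: "sets Q = sets P"
    and ac: "absolutely_continuous P Q"
  shows "\<exists>D. D \<in> borel_measurable P \<and> (\<forall>x. 0 \<le> D x) \<and> integrable P D \<and> Q = density P (\<lambda>x. ennreal (D x))"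
proof -
  interpret P: finite_measure P by fact
  interpret Q: finite_measure Q by fact
  define D where "D x = enn2real (RN_deriv P Q x)" for x
  have D[measurable]: "D \<in> borel_measurable P" unfolding D_def by measurable
  have "AE x in P. RN_deriv P Q x = ennreal (D x)"
    using P.RN_deriv_finite[OF Q.sigma_finite_measure_axioms ac sets]
    by eventually_elim (simp add: D_def less_top)
  then have "density P (\<lambda>x. ennreal (D x)) = density P (RN_deriv P Q)"
    by (intro density_cong) auto
  then have Qeq: "Q = density P (\<lambda>x. ennreal (D x))"
    using P.density_RN_deriv[OF ac sets] by simp
  have "(\<integral>\<^sup>+x. ennreal (D x) \<partial>P) = emeasure (density P (\<lambda>x. ennreal (D x))) (space P)"
    by (simp add: emeasure_density cong: nn_integral_cong)
  also have "\<dots> = emeasure Q (space P)" using Qeq by simp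
  also have "\<dots> < top" by (simp add: Q.emeasure_eq_measure)
  finally have "integrable P D" by (intro integrableI_nonneg) (auto simp: D_def)
  then show ?thesis using D Qeq by (intro exI[of _ D]) (simp add: D_def)
qed

text \<open>Radon-Nikodym densities exist pointwise in \<open>I\<close>; joint measurability comes from choosing, for
  each \<open>k\<close>, the first member of a countable dense family that is within \<open>2\<^sup>-\<^sup>k\<close> of the density. By
  \<open>integral_abs_le_algebra\<close> this can be tested on countably many sets, hence measurably in \<open>I\<close>.\<close>

lemma ex_jointly_measurable_density:
  fixes M :: "'a measure" and N :: "'b measure"
  assumes N: "separated_countably_generated N" and P: "P \<in> space (prob_algebra N)"
    and A: "A \<in> M \<rightarrow>\<^sub>M prob_algebra N" and ac: "\<And>I. I \<in> space M \<Longrightarrow> absolutely_continuous P (A I)"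
  shows "\<exists>f :: 'a \<times> 'b \<Rightarrow> real. f \<in> borel_measurable (M \<Otimes>\<^sub>M N) \<and> (\<forall>x. 0 \<le> f x) \<and>
    (\<forall>I\<in>space M. A I = density P (\<lambda>y. ennreal (f (I, y))))"
proof -
  from separated_countably_generatedD[OF N] obtain \<C>
    where \<C>: "countable \<C>" "algebra (space N) \<C>" "sets N = sigma_sets (space N) \<C>" by blast
  interpret P: prob_space P using P by (simp add: space_prob_algebra)
  have setsP[measurable_cong]: "sets P = sets N" using P by (simp add: space_prob_algebra)
  then have spP: "space P = space N" by (rule sets_eq_imp_space_eq)
  have CN[measurable]: "B \<in> sets N" if "B \<in> \<C>" for B using that \<C>(3) by auto
  have algP: "algebra (space P) \<C>" "sets P = sigma_sets (space P) \<C>"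
    using \<C> setsP spP by auto
  from L1_separable[OF P.finite_measure_axioms \<C>(1) algP] obtain s :: "nat \<Rightarrow> 'b \<Rightarrow> real"
    where s: "\<And>n. integrable P (s n)"
      and dense: "\<And>g e. integrable P g \<Longrightarrow> 0 < e \<Longrightarrow> \<exists>n. (\<integral>x. \<bar>g x - s n x\<bar> \<partial>P) < e" by blast
  have sm: "s n \<in> borel_measurable N" for n
    using borel_measurable_integrable[OF s[of n]] setsP by (simp cong: measurable_cong_sets)
  \<comment> \<open>The test compares \<open>s n\<close> with \<open>A I\<close> itself and mentions
    no density, so it depends measurably on \<open>I\<close>.\<close>
  define good where "good I k n \<longleftrightarrow>
    (\<forall>B\<in>\<C>. \<bar>(\<integral>x. s n x * indicator B x \<partial>P) - measure (A I) B\<bar> \<le> (1 / 2) ^ k)" for I and k n :: nat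
  define idx where "idx I k = (LEAST n. good I k n)" for I k
  \<comment> \<open>\<open>lim\<close> is arbitrary where the sequence diverges, for each
    \<open>I\<close> in \<open>space M\<close> a null set; \<open>max 0\<close> makes
    \<open>f\<close> nonnegative there too and leaves a nonnegative limit unchanged.\<close>
  define f where "f x = max 0 (lim (\<lambda>k. s (idx (fst x) k) (snd x)))" for x
  have [measurable]: "(\<lambda>x. measure (A x) S) \<in> borel_measurable M" if "S \<in> \<C>" for S
    using measurable_measure_kernel[OF A CN[OF that]] .
  have good_m: "Measurable.pred M (\<lambda>I. good I k n)" for k n
    unfolding good_def using \<C>(1) by measurable
  have idx_m: "(\<lambda>I. idx I k) \<in> M \<rightarrow>\<^sub>M count_space UNIV" for k
    unfolding idx_def using good_m by measurable
  have "(\<lambda>x. s (idx (fst x) k) (snd x)) \<in> borel_measurable (M \<Otimes>\<^sub>M N)" for k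
  proof (rule measurable_compose_countable)
    show "(\<lambda>x. s n (snd x)) \<in> borel_measurable (M \<Otimes>\<^sub>M N)" for n
      using sm by measurable
    show "(\<lambda>x. idx (fst x) k) \<in> M \<Otimes>\<^sub>M N \<rightarrow>\<^sub>M count_space UNIV"
      using idx_m by measurable
  qed
  then have f: "f \<in> borel_measurable (M \<Otimes>\<^sub>M N)"
    unfolding f_def by (intro borel_measurable_max borel_measurable_const borel_measurable_lim_metric)
  have "A I = density P (\<lambda>y. ennreal (f (I, y)))" if I: "I \<in> space M" for I
  proof -
    note K = kernel_space[OF A I]
    interpret AI: prob_space "A I" by (rule K)
    obtain D where D: "D \<in> borel_measurable P" "\<And>x. 0 \<le> D x" "integrable P D"
      and AI: "A I = density P (\<lambda>x. ennreal (D x))"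
      using ex_real_density[OF P.finite_measure_axioms AI.finite_measure_axioms _ ac[OF I]] K(2) setsP by auto
    have AIB: "measure (A I) B = (\<integral>x. D x * indicator B x \<partial>P)" if "B \<in> \<C>" for B
      unfolding AI using D that CN setsP by (intro measure_density_eq_integral) auto
    have diff: "(\<integral>x. s n x * indicator B x \<partial>P) - measure (A I) B = (\<integral>x. (s n x - D x) * indicator B x \<partial>P)"
      if "B \<in> \<C>" for B n
    proof -
      have BP: "B \<in> sets P" using that CN setsP by auto
      show ?thesis
        unfolding AIB[OF that] left_diff_distrib
        using integrable_real_mult_indicator[OF BP s] integrable_real_mult_indicator[OF BP D(3)]
        by simp
    qed
    have "\<exists>n. good I k n" for k
    proof -
      obtain n where n: "(\<integral>x. \<bar>D x - s n x\<bar> \<partial>P) < (1 / 2) ^ k" using dense[OF D(3), of "(1 / 2) ^ k"] by auto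
      have "\<bar>\<integral>x. (s n x - D x) * indicator B x \<partial>P\<bar> \<le> (1 / 2) ^ k" if "B \<in> \<C>" for B
      proof -
        have "B \<in> sets P" using that CN setsP by auto
        then have i: "integrable P (\<lambda>x. (s n x - D x) * indicator B x)"
          using s D(3) by (intro integrable_real_mult_indicator) auto
        have "\<bar>\<integral>x. (s n x - D x) * indicator B x \<partial>P\<bar> \<le> (\<integral>x. \<bar>(s n x - D x) * indicator B x\<bar> \<partial>P)"
          by (rule integral_abs_bound)
        also have "\<dots> \<le> (\<integral>x. \<bar>D x - s n x\<bar> \<partial>P)"
          using i s D(3) by (intro integral_mono integrable_abs) (auto simp: indicator_def)
        finally show ?thesis using n by simp
      qed
      then show ?thesis unfolding good_def using diff by auto
    qed
    then have good: "good I k (idx I k)" for k unfolding idx_def by (rule LeastI_ex)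
    have "(\<integral>x. \<bar>s (idx I k) x - D x\<bar> \<partial>P) \<le> 2 * (1 / 2) ^ k" for k
      using good[of k] s D(3) unfolding good_def
      by (intro integral_abs_le_algebra[OF P.finite_measure_axioms algP]) (auto simp: diff)
    then have "AE x in P. (\<lambda>k. s (idx I k) x) \<longlonglongrightarrow> D x"
      using s D(3) by (intro AE_tendsto_of_L1_geometric)
    then have "AE x in P. ennreal (D x) = ennreal (f (I, x))"
      by eventually_elim (auto simp: f_def limI D(2) max_absorb2)
    moreover have "(\<lambda>x. f (I, x)) \<in> borel_measurable P"
      using measurable_Pair2[OF f I] setsP by (simp cong: measurable_cong_sets)
    ultimately show ?thesis
      unfolding AI using D(1) by (intro density_cong) auto
  qed
  then show ?thesis using f by (intro exI[of _ f]) (auto simp: f_def)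
qed

subsection \<open>The first point of a Poisson process\<close>

definition first_hit :: "'z set \<Rightarrow> (nat \<Rightarrow> 'z) \<Rightarrow> nat \<Rightarrow> bool" where
  "first_hit S m j \<longleftrightarrow> m j \<in> S \<and> (\<forall>i<j. m i \<notin> S)"

definition arrival :: "(nat \<Rightarrow> real) \<Rightarrow> nat \<Rightarrow> real" where
  "arrival w j = (\<Sum>i\<le>j. w i)"

definition gaps :: "(nat \<Rightarrow> real) measure" where
  "gaps = PiM UNIV (\<lambda>_. density lborel (exponential_density 1))"

text \<open>A Poisson process of rate one with i.i.d. marks of law \<open>Q\<close>: in a sample
  \<open>x\<close>, point \<open>j\<close> has mark \<open>fst x j\<close> and time
  \<open>arrival (snd x) j\<close>, a sum of \<open>j + 1\<close> gaps.\<close>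

definition layer :: "'z measure \<Rightarrow> ((nat \<Rightarrow> 'z) \<times> (nat \<Rightarrow> real)) measure" where
  "layer Q = PiM UNIV (\<lambda>_. Q) \<Otimes>\<^sub>M gaps"

definition layers :: "'z measure \<Rightarrow> (nat \<Rightarrow> (nat \<Rightarrow> 'z) \<times> (nat \<Rightarrow> real)) measure" where
  "layers Q = PiM UNIV (\<lambda>_. layer Q)"

text \<open>The point \<open>(k, j)\<close> is the earliest one in the region \<open>\<Union>k. S k\<close>. Comparing first hits only
  makes \<open>emeasure_winner\<close> independent of the sign of the gaps.\<close>

definition winner :: "(nat \<Rightarrow> 'z set) \<Rightarrow> (nat \<Rightarrow> (nat \<Rightarrow> 'z) \<times> (nat \<Rightarrow> real)) \<Rightarrow> nat \<Rightarrow> nat \<Rightarrow> bool" where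
  "winner S \<omega> k j \<longleftrightarrow> first_hit (S k) (fst (\<omega> k)) j \<and>
     (\<forall>k' i. k' \<noteq> k \<longrightarrow> first_hit (S k') (fst (\<omega> k')) i \<longrightarrow>
        arrival (snd (\<omega> k)) j < arrival (snd (\<omega> k')) i)"

lemma first_hit_unique: "first_hit S m i \<Longrightarrow> first_hit S m j \<Longrightarrow> i = j"
  unfolding first_hit_def by (metis nat_neq_iff)

text \<open>Arrival times are compared strictly, so two winners in different layers would beat each
  other; within a layer the first hit is unique.\<close>

lemma winner_unique:
  assumes "winner S \<omega> k j" "winner S \<omega> k' j'"
  shows "k = k' \<and> j = j'"
proof -
  have "k = k'"
    using assms unfolding winner_def by (metis less_asym)
  then show ?thesis
    using assms first_hit_unique unfolding winner_def by metis
qed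

text \<open>The mechanism of the coupling: passing to a smaller region that still contains the
  earliest point can only delay or remove its competitors. Nonnegative gaps turn a later index into
  a later time.\<close>

lemma winner_subfamily:
  assumes win: "winner T \<omega> k j" and mem: "fst (\<omega> k) j \<in> S k" and sub: "\<And>k. S k \<subseteq> T k"
    and pos: "\<And>k i. 0 \<le> snd (\<omega> k) i"
  shows "winner S \<omega> k j"
  unfolding winner_def
proof (intro conjI allI impI)
  show "first_hit (S k) (fst (\<omega> k)) j"
    using win mem sub unfolding winner_def first_hit_def by blast
  fix k' i assume k': "k' \<noteq> k" and hit: "first_hit (S k') (fst (\<omega> k')) i"
  define i0 where "i0 = (LEAST i. fst (\<omega> k') i \<in> T k')"
  have Ti: "fst (\<omega> k') i \<in> T k'" using hit sub unfolding first_hit_def by auto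
  have "first_hit (T k') (fst (\<omega> k')) i0"
    unfolding first_hit_def i0_def using Ti by (auto intro: LeastI dest: not_less_Least)
  then have "arrival (snd (\<omega> k)) j < arrival (snd (\<omega> k')) i0"
    using win k' unfolding winner_def by blast
  also have "i0 \<le> i" unfolding i0_def using Ti by (rule Least_le)
  then have "arrival (snd (\<omega> k')) i0 \<le> arrival (snd (\<omega> k')) i"
    unfolding arrival_def using pos by (intro sum_mono2) auto
  finally show "arrival (snd (\<omega> k)) j < arrival (snd (\<omega> k')) i" .
qed

lemma prob_space_exponential: "prob_space (density lborel (exponential_density 1))"
  by (rule prob_space_exponential_density) simp

lemma prob_space_gaps: "prob_space gaps"
  unfolding gaps_def by (intro prob_space_PiM prob_space_exponential)

lemma sets_gaps[measurable_cong]: "sets gaps = sets (PiM UNIV (\<lambda>_. borel))"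
  unfolding gaps_def by (intro sets_PiM_cong) auto

lemma sets_layer[measurable_cong]: "sets (layer Q) = sets (PiM UNIV (\<lambda>_. Q) \<Otimes>\<^sub>M PiM UNIV (\<lambda>_. borel))"
  unfolding layer_def by (intro sets_pair_measure_cong sets_gaps refl)

lemma sets_layers[measurable_cong]: "sets (layers Q) = sets (PiM UNIV (\<lambda>_. layer Q))"
  unfolding layers_def ..

lemma prob_space_layer: "prob_space Q \<Longrightarrow> prob_space (layer Q)"
  unfolding layer_def by (intro prob_space_pair prob_space_PiM prob_space_gaps)

lemma prob_space_layers: "prob_space Q \<Longrightarrow> prob_space (layers Q)"
  unfolding layers_def by (intro prob_space_PiM prob_space_layer)

lemma first_hit_measurable[measurable (raw)]:
  assumes [measurable]: "S \<in> sets Q" "f \<in> K \<rightarrow>\<^sub>M PiM UNIV (\<lambda>_. Q)"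
  shows "Measurable.pred K (\<lambda>x. first_hit S (f x) j)"
  unfolding first_hit_def by measurable

lemma arrival_measurable[measurable (raw)]:
  assumes [measurable]: "f \<in> K \<rightarrow>\<^sub>M PiM UNIV (\<lambda>_. borel)"
  shows "(\<lambda>x. arrival (f x) j) \<in> borel_measurable K"
  unfolding arrival_def by measurable

section \<open>Thinning of a single layer\<close>

text \<open>Since \<open>B \<subseteq> S\<close>, the event is a cylinder: \<open>j\<close> marks
  outside \<open>S\<close>, followed by one in \<open>B\<close>.\<close>

lemma emeasure_first_hit:
  assumes Q: "prob_space Q" and [measurable]: "S \<in> sets Q" "B \<in> sets Q" and "B \<subseteq> S"
  shows "emeasure (PiM UNIV (\<lambda>_. Q)) {m \<in> space (PiM UNIV (\<lambda>_. Q)). first_hit S m j \<and> m j \<in> B}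
    = ennreal (measure Q B * (1 - measure Q S) ^ j)"
proof -
  interpret Q: prob_space Q by fact
  interpret product_prob_space "\<lambda>_::nat. Q" UNIV ..
  let ?X = "\<lambda>i. if i = j then B else space Q - S"
  have "{m \<in> space (PiM UNIV (\<lambda>_. Q)). first_hit S m j \<and> m j \<in> B}
     = {m \<in> space (PiM UNIV (\<lambda>_. Q)). \<forall>i\<in>{..<Suc j}. m i \<in> ?X i}"
    using assms(4) by (auto simp: first_hit_def space_PiM less_Suc_eq)
  also have "emeasure (PiM UNIV (\<lambda>_. Q)) \<dots> = (\<Prod>i<Suc j. emeasure Q (?X i))"
    by (rule emeasure_PiM_Collect) auto
  also have "\<dots> = emeasure Q (space Q - S) ^ j * emeasure Q B"
    by simp
  also have "\<dots> = ennreal (measure Q B * (1 - measure Q S) ^ j)"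
    by (simp add: Q.emeasure_eq_measure Q.prob_compl ennreal_mult' ennreal_power mult.commute)
  finally show ?thesis .
qed

text \<open>\<open>arrival w j\<close> adds \<open>j + 1\<close> independent unit exponentials, and
  \<open>erlang_density j\<close> has shape \<open>j + 1\<close>. Independence is read off from
  \<open>gaps\<close> being the product of its marginals.\<close>

lemma arrival_distributed: "distributed gaps lborel (\<lambda>w. arrival w j) (erlang_density j 1)"
proof -
  let ?E = "density lborel (exponential_density 1)"
  interpret E: prob_space ?E by (rule prob_space_exponential)
  interpret P: product_prob_space "\<lambda>_::nat. ?E" UNIV ..
  interpret G: prob_space gaps by (rule prob_space_gaps)
  have comp: "distr gaps borel (\<lambda>w. w i) = ?E" for i
  proof -
    have "distr gaps borel (\<lambda>w. w i) = distr gaps ?E (\<lambda>w. w i)"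
      by (intro distr_cong) auto
    also have "\<dots> = ?E" unfolding gaps_def by (rule P.PiM_component) simp
    finally show ?thesis .
  qed
  have "G.indep_vars (\<lambda>_. borel) (\<lambda>i w. w i) UNIV"
  proof (subst G.indep_vars_iff_distr_eq_PiM)
    have "distr gaps (PiM UNIV (\<lambda>_. borel)) (\<lambda>x. x) = gaps"
      by (intro distr_id2 sets_gaps[symmetric])
    then show "distr gaps (PiM UNIV (\<lambda>_. borel)) (\<lambda>x. \<lambda>i\<in>UNIV. x i)
        = PiM UNIV (\<lambda>i. distr gaps borel (\<lambda>w. w i))"
      unfolding comp by (simp add: gaps_def restrict_def)
  qed auto
  then have ind: "G.indep_vars (\<lambda>_. borel) (\<lambda>i w. w i) {..j}"
    by (rule G.indep_vars_subset) auto
  have "distributed gaps lborel (\<lambda>w. w i) (exponential_density 1)" for i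
    unfolding distributed_def using comp[of i]
    by (auto cong: distr_cong simp: measurable_lborel1)
  from G.exponential_distributed_sum[OF _ _ _ this ind]
  show ?thesis by (simp add: arrival_def)
qed

text \<open>The terms \<open>((1 - a) * t) ^ j / fact j\<close> form an exponential series, and
  \<open>exp (- t) * exp ((1 - a) * t)\<close> is \<open>exp (- a * t)\<close>.\<close>

lemma suminf_first_hit_erlang:
  assumes a: "a \<le> 1" and b: "0 \<le> b"
  shows "(\<Sum>j. ennreal (b * (1 - a) ^ j) * ennreal (erlang_density j 1 t))
    = ennreal (b * exp (- a * t)) * indicator {0..} t"
proof (cases "0 \<le> t")
  case True
  have "(\<lambda>j. ((1 - a) * t) ^ j /\<^sub>R fact j) sums exp ((1 - a) * t)"
    by (rule exp_converges)
  then have "(\<lambda>j. b * exp (- t) * (((1 - a) * t) ^ j /\<^sub>R fact j)) sums (b * exp (- t) * exp ((1 - a) * t))"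
    by (rule sums_mult)
  moreover have "b * exp (- t) * exp ((1 - a) * t) = b * exp (- a * t)"
    by (simp add: exp_add[symmetric] algebra_simps)
  moreover have "b * exp (- t) * (((1 - a) * t) ^ j /\<^sub>R fact j) = b * (1 - a) ^ j * erlang_density j 1 t" for j
    using True by (simp add: erlang_density_def power_mult_distrib divide_inverse mult_ac)
  ultimately have "(\<lambda>j. b * (1 - a) ^ j * erlang_density j 1 t) sums (b * exp (- a * t))"
    by (simp only:)
  then have "(\<Sum>j. ennreal (b * (1 - a) ^ j * erlang_density j 1 t)) = ennreal (b * exp (- a * t))"
    using a b by (intro suminf_ennreal_eq) auto
  then show ?thesis
    using True a b by (simp add: ennreal_mult)
next
  case False
  then show ?thesis by (simp add: erlang_density_def)
qed

text \<open>The first hit of \<open>S\<close> in a layer arrives after an exponential time with rate \<open>measure Q S\<close>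
  (thinning), and its mark is uniform on \<open>S\<close> and independent of that time.\<close>

lemma suminf_nn_integral_layer:
  assumes Q: "prob_space Q" and S[measurable]: "S \<in> sets Q" and B[measurable]: "B \<in> sets Q"
    and "B \<subseteq> S" and g[measurable]: "g \<in> borel_measurable borel"
  shows "(\<Sum>j. \<integral>\<^sup>+x. indicator {x. first_hit S (fst x) j \<and> fst x j \<in> B} x * g (arrival (snd x) j) \<partial>layer Q)
    = (\<integral>\<^sup>+t. ennreal (measure Q B * exp (- measure Q S * t)) * indicator {0..} t * g t \<partial>lborel)"
proof -
  interpret Q: prob_space Q by fact
  interpret P: prob_space "PiM UNIV (\<lambda>_::nat. Q)" by (intro prob_space_PiM Q)
  interpret G: prob_space gaps by (rule prob_space_gaps)
  have "(\<integral>\<^sup>+x. indicator {x. first_hit S (fst x) j \<and> fst x j \<in> B} x * g (arrival (snd x) j) \<partial>layer Q)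
     = (\<integral>\<^sup>+t. ennreal (measure Q B * (1 - measure Q S) ^ j) * ennreal (erlang_density j 1 t) * g t \<partial>lborel)" for j
  proof -
    let ?h = "\<lambda>x. indicator {x. first_hit S (fst x) j \<and> fst x j \<in> B} x * g (arrival (snd x) j) :: ennreal"
    let ?A = "{m \<in> space (PiM UNIV (\<lambda>_. Q)). first_hit S m j \<and> m j \<in> B}"
    \<comment> \<open>Marks and gaps are independent, so the integral factors into the probability
      of the hit and an expectation over the arrival time.\<close>
    have "(\<integral>\<^sup>+x. ?h x \<partial>layer Q) = (\<integral>\<^sup>+m. \<integral>\<^sup>+w. ?h (m, w) \<partial>gaps \<partial>PiM UNIV (\<lambda>_. Q))"
      unfolding layer_def by (intro G.nn_integral_fst[symmetric]) measurable
    also have "\<dots> = (\<integral>\<^sup>+m. indicator ?A m * (\<integral>\<^sup>+w. g (arrival w j) \<partial>gaps) \<partial>PiM UNIV (\<lambda>_. Q))"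
      by (intro nn_integral_cong) (auto simp: indicator_def nn_integral_cmult)
    also have "\<dots> = emeasure (PiM UNIV (\<lambda>_. Q)) ?A * (\<integral>\<^sup>+w. g (arrival w j) \<partial>gaps)"
      by (subst nn_integral_multc) auto
    also have "(\<integral>\<^sup>+w. g (arrival w j) \<partial>gaps) = (\<integral>\<^sup>+t. ennreal (erlang_density j 1 t) * g t \<partial>lborel)"
      by (rule distributed_nn_integral[OF arrival_distributed, symmetric]) simp
    also have "emeasure (PiM UNIV (\<lambda>_. Q)) ?A = ennreal (measure Q B * (1 - measure Q S) ^ j)"
      by (rule emeasure_first_hit) fact+
    also have "ennreal (measure Q B * (1 - measure Q S) ^ j) * (\<integral>\<^sup>+t. ennreal (erlang_density j 1 t) * g t \<partial>lborel)
       = (\<integral>\<^sup>+t. ennreal (measure Q B * (1 - measure Q S) ^ j) * ennreal (erlang_density j 1 t) * g t \<partial>lborel)"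
      by (subst nn_integral_cmult[symmetric]) (auto simp: mult.assoc)
    finally show ?thesis .
  qed
  then have "(\<Sum>j. \<integral>\<^sup>+x. indicator {x. first_hit S (fst x) j \<and> fst x j \<in> B} x * g (arrival (snd x) j) \<partial>layer Q)
    = (\<Sum>j. \<integral>\<^sup>+t. ennreal (measure Q B * (1 - measure Q S) ^ j) * ennreal (erlang_density j 1 t) * g t \<partial>lborel)"
    by simp
  also have "\<dots> = (\<integral>\<^sup>+t. (\<Sum>j. ennreal (measure Q B * (1 - measure Q S) ^ j) * ennreal (erlang_density j 1 t) * g t) \<partial>lborel)"
    by (intro nn_integral_suminf[symmetric]) auto
  also have "\<dots> = (\<integral>\<^sup>+t. ennreal (measure Q B * exp (- measure Q S * t)) * indicator {0..} t * g t \<partial>lborel)"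
    by (intro nn_integral_cong)
       (simp add: suminf_first_hit_erlang[OF Q.prob_le_1 measure_nonneg])
  finally show ?thesis .
qed

text \<open>A layer that never hits \<open>S\<close> counts as late, so the exponential formula
  covers null sets \<open>S\<close>.\<close>

definition late_layer :: "'z measure \<Rightarrow> 'z set \<Rightarrow> real \<Rightarrow> ((nat \<Rightarrow> 'z) \<times> (nat \<Rightarrow> real)) set" where
  "late_layer Q S t = {x \<in> space (layer Q). \<forall>i. first_hit S (fst x) i \<longrightarrow> t < arrival (snd x) i}"

lemma late_layer_sets[measurable]:
  assumes [measurable]: "S \<in> sets Q"
  shows "late_layer Q S t \<in> sets (layer Q)"
  unfolding late_layer_def by measurable

text \<open>The complement splits into disjoint events by the index of the first hit. With
  \<open>B = S\<close> and the indicator of \<open>{..t}\<close> as \<open>g\<close>,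
  \<open>suminf_nn_integral_layer\<close> adds them up to an exponential distribution
  function.\<close>

lemma measure_late_layer:
  assumes Q: "prob_space Q" and S[measurable]: "S \<in> sets Q" and t: "0 \<le> t"
  shows "measure (layer Q) (late_layer Q S t) = exp (- measure Q S * t)"
proof -
  interpret L: prob_space "layer Q" by (intro prob_space_layer Q)
  let ?a = "measure Q S"
  let ?E = "\<lambda>j. {x \<in> space (layer Q). first_hit S (fst x) j \<and> arrival (snd x) j \<le> t}"
  have E[measurable]: "?E j \<in> sets (layer Q)" for j by measurable
  have "emeasure (layer Q) (\<Union>j. ?E j) = (\<Sum>j. emeasure (layer Q) (?E j))"
    by (intro suminf_emeasure[symmetric])
       (auto simp: disjoint_family_on_def dest: first_hit_unique)
  also have "\<dots> = (\<Sum>j. \<integral>\<^sup>+x. indicator {x. first_hit S (fst x) j \<and> fst x j \<in> S} x * indicator {..t} (arrival (snd x) j) \<partial>layer Q)"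
  proof (intro suminf_cong)
    fix j
    have "emeasure (layer Q) (?E j) = (\<integral>\<^sup>+x. indicator (?E j) x \<partial>layer Q)" by simp
    also have "\<dots> = (\<integral>\<^sup>+x. indicator {x. first_hit S (fst x) j \<and> fst x j \<in> S} x * indicator {..t} (arrival (snd x) j) \<partial>layer Q)"
      by (intro nn_integral_cong) (auto simp: indicator_def first_hit_def)
    finally show "emeasure (layer Q) (?E j) = \<dots>" .
  qed
  also have "\<dots> = (\<integral>\<^sup>+s. ennreal (?a * exp (- ?a * s)) * indicator {0..} s * indicator {..t} s \<partial>lborel)"
    by (intro suminf_nn_integral_layer Q) auto
  also have "\<dots> = (\<integral>\<^sup>+s. ennreal (?a * exp (- ?a * s)) * indicator {0..t} s \<partial>lborel)"
    by (intro nn_integral_cong) (auto simp: indicator_def)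
  also have "\<dots> = ennreal (- exp (- ?a * t) - (- exp (- ?a * 0)))"
    using t by (intro nn_integral_FTC_Icc) (auto intro!: derivative_eq_intros)
  finally have "measure (layer Q) (\<Union>j. ?E j) = 1 - exp (- ?a * t)"
    using t by (simp add: L.emeasure_eq_measure mult_nonneg_nonneg)
  moreover have "late_layer Q S t = space (layer Q) - (\<Union>j. ?E j)"
    by (auto simp: late_layer_def not_le)
  ultimately show ?thesis
    by (simp add: L.prob_compl)
qed

section \<open>Competition between independent layers\<close>

text \<open>Used to condition on one layer: \<open>x\<close> becomes a separate independent variable
  while the other layers stay inside a full product over \<open>UNIV\<close>, so the index set need
  not be split.\<close>

lemma distr_PiM_fun_upd:
  assumes L: "prob_space L"
  shows "distr (L \<Otimes>\<^sub>M PiM UNIV (\<lambda>_. L)) (PiM UNIV (\<lambda>_. L)) (\<lambda>(x, \<omega>). fun_upd \<omega> k x) = PiM UNIV (\<lambda>_. L)"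
proof -
  interpret L: prob_space L by fact
  interpret P: product_prob_space "\<lambda>_. L" UNIV ..
  have m[measurable]: "(\<lambda>(x, \<omega>). fun_upd \<omega> k x) \<in> L \<Otimes>\<^sub>M PiM UNIV (\<lambda>_. L) \<rightarrow>\<^sub>M PiM UNIV (\<lambda>_. L)"
    unfolding split_beta' by (rule measurable_fun_upd[where J = UNIV and I=UNIV]) auto
  show ?thesis
  proof (rule P.PiM_eq)
    fix J F assume J: "finite J" "J \<subseteq> (UNIV :: 'b set)" and F: "\<And>j. j \<in> J \<Longrightarrow> F j \<in> sets L"
    let ?P = "PiM (UNIV :: 'b set) (\<lambda>_. L)"
    let ?F = "if k \<in> J then F k else space L"
    let ?E = "{\<omega> \<in> space ?P. \<forall>j\<in>J. \<omega> j \<in> F j}"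
    let ?R = "{\<omega> \<in> space ?P. \<forall>j\<in>J - {k}. \<omega> j \<in> F j}"
    have emb: "prod_emb UNIV (\<lambda>_. L) J (\<Pi>\<^sub>E j\<in>J. F j) = ?E"
      unfolding prod_emb_def by (auto simp: space_PiM Pi_iff)
    have E: "?E \<in> sets ?P" unfolding emb[symmetric] using J F by (intro sets_PiM_I) auto
    have R: "?R \<in> sets ?P"
      using J F by (intro sets.sets_Collect_finite_All sets_Collect_single') auto
    have F': "?F \<in> sets L" using F by auto
    have "(\<lambda>(x, \<omega>). fun_upd \<omega> k x) -` ?E \<inter> space (L \<Otimes>\<^sub>M ?P) = ?F \<times> ?R"
    proof (intro set_eqI iffI)
      fix y assume "y \<in> (\<lambda>(x, \<omega>). fun_upd \<omega> k x) -` ?E \<inter> space (L \<Otimes>\<^sub>M ?P)"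
      then obtain x \<omega> where y: "y = (x, \<omega>)" "x \<in> space L" "\<omega> \<in> space ?P" "\<forall>j\<in>J. (fun_upd \<omega> k x) j \<in> F j"
        by (auto simp: space_pair_measure)
      have "\<omega> j \<in> F j" if "j \<in> J - {k}" for j using y(4) that by (auto dest: bspec[of _ _ j])
      moreover have "x \<in> F k" if "k \<in> J" using y(4) that by (auto dest: bspec[of _ _ k])
      ultimately show "y \<in> ?F \<times> ?R" using y by auto
    next
      fix y assume "y \<in> ?F \<times> ?R"
      then obtain x \<omega> where y: "y = (x, \<omega>)" "x \<in> ?F" "\<omega> \<in> space ?P" "\<forall>j\<in>J - {k}. \<omega> j \<in> F j"
        by auto
      have x: "x \<in> space L" using y(2) F'[THEN sets.sets_into_space] by auto
      then have "fun_upd \<omega> k x \<in> space ?P" using y(3) by (auto simp: space_PiM PiE_iff)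
      moreover have "(fun_upd \<omega> k x) j \<in> F j" if "j \<in> J" for j using y that by (auto split: if_splits)
      ultimately show "y \<in> (\<lambda>(x, \<omega>). fun_upd \<omega> k x) -` ?E \<inter> space (L \<Otimes>\<^sub>M ?P)"
        using y(1,3) x by (simp add: space_pair_measure)
    qed
    then have "emeasure (distr (L \<Otimes>\<^sub>M ?P) ?P (\<lambda>(x, \<omega>). fun_upd \<omega> k x)) ?E
      = emeasure (L \<Otimes>\<^sub>M ?P) (?F \<times> ?R)"
      using E by (subst emeasure_distr) auto
    also have "\<dots> = emeasure L ?F * emeasure ?P ?R"
      using F' R by (rule P.emeasure_pair_measure_Times)
    also have "emeasure ?P ?R = (\<Prod>j\<in>J - {k}. emeasure L (F j))"
      using J F by (intro P.emeasure_PiM_Collect) auto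
    also have "emeasure L ?F * \<dots> = (\<Prod>j\<in>J. emeasure L (F j))"
      using J by (auto simp: prod.remove L.emeasure_space_1)
    finally show "emeasure (distr (L \<Otimes>\<^sub>M ?P) ?P (\<lambda>(x, \<omega>). fun_upd \<omega> k x))
        (prod_emb UNIV (\<lambda>_. L) J (\<Pi>\<^sub>E j\<in>J. F j)) = (\<Prod>j\<in>J. emeasure L (F j))"
      unfolding emb .
  qed simp
qed

text \<open>Independence gives an infinite product of \<open>exp (- measure Q (S i) * t)\<close>
  over \<open>i \<noteq> k\<close>; the rates add up to \<open>s - measure Q (S k)\<close>.\<close>

lemma measure_late_layers:
  assumes Q: "prob_space Q" and S[measurable]: "\<And>k. S k \<in> sets Q"
    and sums: "(\<lambda>k. measure Q (S k)) sums s" and t: "0 \<le> t"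
  shows "emeasure (layers Q) {\<omega> \<in> space (layers Q). \<forall>k'. k' \<noteq> k \<longrightarrow> \<omega> k' \<in> late_layer Q (S k') t}
    = ennreal (exp (- (s - measure Q (S k)) * t))"
proof -
  interpret L: prob_space "layer Q" by (intro prob_space_layer Q)
  interpret LS: prob_space "layers Q" by (intro prob_space_layers Q)
  interpret P: sequence_space "layer Q" ..
  let ?E = "\<lambda>k'. if k' = k then space (layer Q) else late_layer Q (S k') t"
  let ?a = "\<lambda>k'. if k' = k then 0 else measure Q (S k')"
  have E: "?E k' \<in> sets (layer Q)" for k' by simp
  have "(\<Prod>i\<le>n. measure (layer Q) (?E i)) = exp (- (\<Sum>i\<le>n. ?a i) * t)" for n
  proof -
    have "(\<Prod>i\<le>n. measure (layer Q) (?E i)) = (\<Prod>i\<le>n. exp (- ?a i * t))"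
      using t by (intro prod.cong) (auto simp: measure_late_layer[OF Q S] L.prob_space)
    also have "\<dots> = exp (\<Sum>i\<le>n. - ?a i * t)" by (rule exp_sum[symmetric]) simp
    finally show ?thesis by (simp add: sum_distrib_right sum_negf)
  qed
  then have 1: "(\<lambda>n. exp (- (\<Sum>i\<le>n. ?a i) * t)) \<longlonglongrightarrow> measure (layers Q) (Pi UNIV ?E)"
    using P.measure_PiM_countable[of ?E, OF E] unfolding layers_def by (simp only:)
  have "(\<lambda>k'. measure Q (S k') - (if k' = k then measure Q (S k') else 0)) sums (s - measure Q (S k))"
    by (intro sums_diff sums sums_single)
  then have "?a sums (s - measure Q (S k))"
    by (rule sums_cong[THEN iffD1, rotated]) auto
  then have "(\<lambda>n. exp (- (\<Sum>i\<le>n. ?a i) * t)) \<longlonglongrightarrow> exp (- (s - measure Q (S k)) * t)"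
    unfolding sums_def_le by (intro tendsto_intros)
  with 1 have "measure (layers Q) (Pi UNIV ?E) = exp (- (s - measure Q (S k)) * t)"
    by (rule LIMSEQ_unique)
  moreover have "\<omega> \<in> Pi UNIV ?E \<longleftrightarrow>
    \<omega> \<in> {\<omega> \<in> space (layers Q). \<forall>k'. k' \<noteq> k \<longrightarrow> \<omega> k' \<in> late_layer Q (S k') t}" for \<omega>
  proof -
    have sp: "\<omega> \<in> space (layers Q) \<longleftrightarrow> (\<forall>i. \<omega> i \<in> space (layer Q))"
      by (simp add: layers_def space_PiM PiE_iff)
    have "late_layer Q (S i) t \<subseteq> space (layer Q)" for i
      by (auto simp: late_layer_def)
    then show ?thesis
      unfolding Pi_iff mem_Collect_eq sp by (metis UNIV_I in_mono)
  qed
  then have "Pi UNIV ?E = {\<omega> \<in> space (layers Q). \<forall>k'. k' \<noteq> k \<longrightarrow> \<omega> k' \<in> late_layer Q (S k') t}"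
    by (rule set_eqI)
  ultimately show ?thesis
    by (simp only: LS.emeasure_eq_measure)
qed

lemma winner_measurable[measurable]:
  assumes S[measurable]: "\<And>k. S k \<in> sets Q"
  shows "Measurable.pred (layers Q) (\<lambda>\<omega>. winner S \<omega> k j)"
  unfolding winner_def by measurable

text \<open>Given that the first hit of layer \<open>k\<close> arrives at time \<open>t\<close>, it wins iff all other layers are late,
  which has probability \<open>exp (- (s - measure Q (S k)) * t)\<close>.\<close>

lemma emeasure_winner:
  assumes Q: "prob_space Q" and S[measurable]: "\<And>k. S k \<in> sets Q" and B[measurable]: "B \<in> sets Q"
    and "B \<subseteq> S k" and sums: "(\<lambda>k. measure Q (S k)) sums s" and s: "0 < s"
  shows "(\<Sum>j. emeasure (layers Q) {\<omega> \<in> space (layers Q). winner S \<omega> k j \<and> fst (\<omega> k) j \<in> B})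
    = ennreal (measure Q B / s)"
proof -
  interpret L: prob_space "layer Q" by (intro prob_space_layer Q)
  interpret P: prob_space "layers Q" by (intro prob_space_layers Q)
  let ?C = "\<lambda>t. {\<omega> \<in> space (layers Q). \<forall>k'. k' \<noteq> k \<longrightarrow> \<omega> k' \<in> late_layer Q (S k') t}"
  \<comment> \<open>\<open>V\<close> becomes the function \<open>g\<close> of
    \<open>suminf_nn_integral_layer\<close> and so has to be measurable in \<open>t\<close>.\<close>
  define V where "V t = emeasure (layers Q) (?C t)" for t
  have C: "{x \<in> space (borel \<Otimes>\<^sub>M layers Q). \<forall>k'. k' \<noteq> k \<longrightarrow> snd x k' \<in> late_layer Q (S k') (fst x)} \<in> sets (borel \<Otimes>\<^sub>M layers Q)"
  proof -
    have "Measurable.pred (borel \<Otimes>\<^sub>M layers Q) (\<lambda>x. snd x k' \<in> space (layer Q) \<and>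
       (\<forall>i. first_hit (S k') (fst (snd x k')) i \<longrightarrow> fst x < arrival (snd (snd x k')) i))" for k'
      by measurable
    then show ?thesis unfolding late_layer_def by simp
  qed
  have V[measurable]: "V \<in> borel_measurable borel"
  proof -
    have "(\<lambda>t. emeasure (layers Q) (Pair t -` {x \<in> space (borel \<Otimes>\<^sub>M layers Q). \<forall>k'. k' \<noteq> k \<longrightarrow> snd x k' \<in> late_layer Q (S k') (fst x)}))
       \<in> borel_measurable borel"
      by (rule P.measurable_emeasure_Pair[OF C])
    also have "(\<lambda>t. emeasure (layers Q) (Pair t -` {x \<in> space (borel \<Otimes>\<^sub>M layers Q). \<forall>k'. k' \<noteq> k \<longrightarrow> snd x k' \<in> late_layer Q (S k') (fst x)})) = V"
      unfolding V_def by (intro ext arg_cong2[where f=emeasure]) (auto simp: space_pair_measure)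
    finally show ?thesis .
  qed
  have "emeasure (layers Q) {\<omega> \<in> space (layers Q). winner S \<omega> k j \<and> fst (\<omega> k) j \<in> B}
    = (\<integral>\<^sup>+x. indicator {x. first_hit (S k) (fst x) j \<and> fst x j \<in> B} x * V (arrival (snd x) j) \<partial>layer Q)" for j
  proof -
    let ?W = "{\<omega> \<in> space (layers Q). winner S \<omega> k j \<and> fst (\<omega> k) j \<in> B}"
    let ?u = "\<lambda>(x, \<omega>). fun_upd \<omega> k x"
    have W: "?W \<in> sets (layers Q)" by measurable
    have u: "?u \<in> layer Q \<Otimes>\<^sub>M layers Q \<rightarrow>\<^sub>M layers Q"
      unfolding layers_def split_beta'
      by (rule measurable_fun_upd[where J = UNIV and I=UNIV]) auto
    have "emeasure (layers Q) ?W = emeasure (distr (layer Q \<Otimes>\<^sub>M layers Q) (layers Q) ?u) ?W"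
      using distr_PiM_fun_upd[OF L.prob_space_axioms, of k] by (simp add: layers_def)
    also have "\<dots> = emeasure (layer Q \<Otimes>\<^sub>M layers Q) (?u -` ?W \<inter> space (layer Q \<Otimes>\<^sub>M layers Q))"
      by (rule emeasure_distr[OF u W])
    also have "\<dots> = (\<integral>\<^sup>+x. emeasure (layers Q) (Pair x -` (?u -` ?W \<inter> space (layer Q \<Otimes>\<^sub>M layers Q))) \<partial>layer Q)"
      by (rule P.emeasure_pair_measure_alt[OF measurable_sets[OF u W]])
    also have "\<dots> = (\<integral>\<^sup>+x. indicator {x. first_hit (S k) (fst x) j \<and> fst x j \<in> B} x * V (arrival (snd x) j) \<partial>layer Q)"
    proof (intro nn_integral_cong)
      \<comment> \<open>Once layer \<open>k\<close> is fixed to a hitting \<open>x\<close>, winning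
        is a condition on the other layers only.\<close>
      fix x assume x: "x \<in> space (layer Q)"
      have "Pair x -` (?u -` ?W \<inter> space (layer Q \<Otimes>\<^sub>M layers Q))
        = (if first_hit (S k) (fst x) j \<and> fst x j \<in> B then ?C (arrival (snd x) j) else {})"
        using x by (auto simp: space_pair_measure winner_def late_layer_def layers_def space_PiM PiE_iff)
      then show "emeasure (layers Q) (Pair x -` (?u -` ?W \<inter> space (layer Q \<Otimes>\<^sub>M layers Q)))
        = indicator {x. first_hit (S k) (fst x) j \<and> fst x j \<in> B} x * V (arrival (snd x) j)"
        by (simp add: V_def)
    qed
    finally show ?thesis .
  qed
  then have "(\<Sum>j. emeasure (layers Q) {\<omega> \<in> space (layers Q). winner S \<omega> k j \<and> fst (\<omega> k) j \<in> B})
    = (\<integral>\<^sup>+t. ennreal (measure Q B * exp (- measure Q (S k) * t)) * indicator {0..} t * V t \<partial>lborel)"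
    using suminf_nn_integral_layer[OF Q S B \<open>B \<subseteq> S k\<close> V] by simp
  also have "\<dots> = (\<integral>\<^sup>+t. ennreal (measure Q B * exp (- s * t)) * indicator {0..} t \<partial>lborel)"
  proof (intro nn_integral_cong)
    fix t :: real
    show "ennreal (measure Q B * exp (- measure Q (S k) * t)) * indicator {0..} t * V t
      = ennreal (measure Q B * exp (- s * t)) * indicator {0..} t"
    \<comment> \<open>\<open>V\<close> is computed for nonnegative times; the indicator removes the
      others.\<close>
    proof (cases "0 \<le> t")
      case True
      have "exp (- measure Q (S k) * t) * exp (- (s - measure Q (S k)) * t) = exp (- s * t)"
        by (simp add: exp_add[symmetric] algebra_simps)
      then show ?thesis
        using True by (simp add: V_def measure_late_layers[OF Q S sums True] ennreal_mult[symmetric] mult.assoc)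
    qed simp
  qed
  also have "\<dots> = ennreal (0 - (- measure Q B / s * exp (- s * 0)))"
  proof (intro nn_integral_FTC_atLeast)
    show "((\<lambda>t. - measure Q B / s * exp (- s * t)) \<longlongrightarrow> 0) at_top"
      using s by real_asymp
    show "((\<lambda>t. - measure Q B / s * exp (- s * t)) has_real_derivative measure Q B * exp (- s * x)) (at x)" for x
      using s by (auto intro!: derivative_eq_intros)
  qed auto
  finally show ?thesis by simp
qed

text \<open>By \<open>winner_unique\<close> the events for different \<open>(k, j)\<close> are
  disjoint, so the values of \<open>emeasure_winner\<close> add up. For \<open>B = S\<close> the
  result is 1: a winner exists almost surely.\<close>

lemma measure_winner:
  assumes Q: "prob_space Q" and S[measurable]: "\<And>k. S k \<in> sets Q" and B[measurable]: "\<And>k. B k \<in> sets Q"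
    and BS: "\<And>k. B k \<subseteq> S k" and sums: "(\<lambda>k. measure Q (S k)) sums s" and s: "0 < s"
    and sumsB: "(\<lambda>k. measure Q (B k)) sums b"
  shows "measure (layers Q) {\<omega> \<in> space (layers Q). \<exists>k j. winner S \<omega> k j \<and> fst (\<omega> k) j \<in> B k} = b / s"
proof -
  interpret P: prob_space "layers Q" by (intro prob_space_layers Q)
  let ?W = "\<lambda>k j. {\<omega> \<in> space (layers Q). winner S \<omega> k j \<and> fst (\<omega> k) j \<in> B k}"
  have W[measurable]: "?W k j \<in> sets (layers Q)" for k j by measurable
  have "{\<omega> \<in> space (layers Q). \<exists>k j. winner S \<omega> k j \<and> fst (\<omega> k) j \<in> B k} = (\<Union>k. \<Union>j. ?W k j)"
    by auto
  also have "emeasure (layers Q) \<dots> = (\<Sum>k. emeasure (layers Q) (\<Union>j. ?W k j))"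
    by (intro suminf_emeasure[symmetric])
       (auto simp: disjoint_family_on_def dest: winner_unique)
  also have "\<dots> = (\<Sum>k. \<Sum>j. emeasure (layers Q) (?W k j))"
    by (intro suminf_cong suminf_emeasure[symmetric])
       (auto simp: disjoint_family_on_def dest: winner_unique)
  also have "\<dots> = (\<Sum>k. ennreal (measure Q (B k) / s))"
    using emeasure_winner[OF Q S B BS sums s] by simp
  also have "\<dots> = ennreal (b / s)"
    using s by (intro suminf_ennreal_eq sums_divide sumsB) auto
  finally show ?thesis
    using s sumsB suminf_nonneg[of "\<lambda>k. measure Q (B k)"]
    by (auto simp: P.emeasure_eq_measure sums_iff)
qed

subsection \<open>Poisson coupling of densities\<close>

text \<open>Layer \<open>k\<close> carries the points of the process with height in \<open>[k, k + 1]\<close>; the second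
  component of a mark is the height minus \<open>k\<close>.\<close>

definition mark_space :: "'b measure \<Rightarrow> ('b \<times> real) measure" where
  "mark_space P = P \<Otimes>\<^sub>M uniform_measure lborel {0..1}"

text \<open>The second component ranges over all of \<open>borel\<close>, so
  \<open>0 \<le> snd z\<close> is imposed. With the strict upper bound it forces \<open>h\<close> to
  be positive at every point of a slab.\<close>

definition slab :: "'b measure \<Rightarrow> ('b \<Rightarrow> real) \<Rightarrow> nat \<Rightarrow> ('b \<times> real) set" where
  "slab P h k = {z \<in> space (mark_space P). 0 \<le> snd z \<and> real k + snd z < h (fst z)}"

lemma prob_space_uniform: "prob_space (uniform_measure lborel {0..1::real})"
  by (intro prob_space_uniform_measure) auto

lemma prob_space_mark_space: "prob_space P \<Longrightarrow> prob_space (mark_space P)"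
  unfolding mark_space_def by (intro prob_space_pair prob_space_uniform)

lemma sets_mark_space[measurable_cong]: "sets (mark_space P) = sets (P \<Otimes>\<^sub>M borel)"
  unfolding mark_space_def by (intro sets_pair_measure_cong) auto

lemma slab_sets[measurable]:
  assumes [measurable]: "h \<in> borel_measurable P"
  shows "slab P h k \<in> sets (mark_space P)"
  unfolding slab_def by measurable

text \<open>The part of \<open>[k, k + 1]\<close> below \<open>c\<close> has the clamped length, and
  the partial sums \<open>min c n\<close> are eventually constant.\<close>

lemma sums_clamp:
  fixes c :: real
  assumes "0 \<le> c"
  shows "(\<lambda>k. max 0 (min 1 (c - real k))) sums c"
proof -
  have "(\<Sum>k<n. max 0 (min 1 (c - real k))) = min c (real n)" for n
    using assms by (induction n) (auto simp: min_def max_def)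
  moreover have "(\<lambda>n. min c (real n)) \<longlonglongrightarrow> c"
  proof (rule tendsto_eventually)
    show "\<forall>\<^sub>F n in sequentially. min c (real n) = c"
      using eventually_ge_at_top[of "nat \<lceil>c\<rceil>"] by eventually_elim linarith
  qed
  ultimately show ?thesis by (simp add: sums_def)
qed

lemma emeasure_uniform_below:
  fixes c :: real
  shows "emeasure (uniform_measure lborel {0..1}) {y. 0 \<le> y \<and> y < c} = ennreal (max 0 (min 1 c))"
proof -
  have "emeasure (uniform_measure lborel {0..1}) {y. 0 \<le> y \<and> y < c}
    = emeasure lborel ({0..1} \<inter> {y. 0 \<le> y \<and> y < c})"
    by (subst emeasure_uniform_measure) (simp_all add: divide_ennreal_def)
  also have "{0..1} \<inter> {y. 0 \<le> y \<and> y < c} = (if c \<le> 0 then {} else if c \<le> 1 then {0..<c} else {0..1})"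
    by auto
  also have "emeasure lborel \<dots> = ennreal (max 0 (min 1 c))"
    by (simp add: ennreal_neg)
  finally show ?thesis .
qed

text \<open>The area below \<open>h\<close> is sliced at integer heights; \<open>sums_clamp\<close>
  adds up the slices over each \<open>x\<close>, and Tonelli's theorem exchanges sum and
  integral.\<close>

lemma sums_measure_slab:
  assumes P: "prob_space P" and h: "integrable P h" and nonneg: "\<And>x. 0 \<le> h x"
  shows "(\<lambda>k. measure (mark_space P) (slab P h k)) sums (\<integral>x. h x \<partial>P)"
proof -
  interpret P: prob_space P by fact
  interpret U: prob_space "uniform_measure lborel {0..1::real}" by (rule prob_space_uniform)
  interpret Q: prob_space "mark_space P" by (intro prob_space_mark_space P)
  have [measurable]: "h \<in> borel_measurable P" using h by auto
  have "emeasure (mark_space P) (slab P h k) = (\<integral>\<^sup>+x. ennreal (max 0 (min 1 (h x - real k))) \<partial>P)" for k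
  proof -
    have "emeasure (mark_space P) (slab P h k)
      = (\<integral>\<^sup>+x. emeasure (uniform_measure lborel {0..1}) (Pair x -` slab P h k) \<partial>P)"
      using slab_sets[of h P k] unfolding mark_space_def by (intro U.emeasure_pair_measure_alt) auto
    also have "\<dots> = (\<integral>\<^sup>+x. ennreal (max 0 (min 1 (h x - real k))) \<partial>P)"
    proof (intro nn_integral_cong)
      fix x assume "x \<in> space P"
      then have "Pair x -` slab P h k = {y. 0 \<le> y \<and> y < h x - real k}"
        by (auto simp: slab_def mark_space_def space_pair_measure)
      then show "emeasure (uniform_measure lborel {0..1}) (Pair x -` slab P h k)
        = ennreal (max 0 (min 1 (h x - real k)))"
        by (simp only: emeasure_uniform_below)
    qed
    finally show ?thesis .
  qed
  then have "(\<Sum>k. ennreal (measure (mark_space P) (slab P h k)))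
    = (\<Sum>k. \<integral>\<^sup>+x. ennreal (max 0 (min 1 (h x - real k))) \<partial>P)"
    by (simp add: Q.emeasure_eq_measure)
  also have "\<dots> = (\<integral>\<^sup>+x. (\<Sum>k. ennreal (max 0 (min 1 (h x - real k)))) \<partial>P)"
    by (intro nn_integral_suminf[symmetric]) auto
  also have "\<dots> = (\<integral>\<^sup>+x. ennreal (h x) \<partial>P)"
    by (intro nn_integral_cong suminf_ennreal_eq sums_clamp nonneg) auto
  also have "\<dots> = ennreal (\<integral>x. h x \<partial>P)"
    using h nonneg by (intro nn_integral_eq_integral) auto
  finally have *: "(\<Sum>k. ennreal (measure (mark_space P) (slab P h k))) = ennreal (\<integral>x. h x \<partial>P)" .
  then have sm: "summable (\<lambda>k. measure (mark_space P) (slab P h k))"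
    by (intro summable_suminf_not_top) auto
  then have "ennreal (\<Sum>k. measure (mark_space P) (slab P h k)) = ennreal (\<integral>x. h x \<partial>P)"
    using * by (simp add: suminf_ennreal2)
  then have "(\<Sum>k. measure (mark_space P) (slab P h k)) = (\<integral>x. h x \<partial>P)"
    using nonneg by (subst (asm) ennreal_inj) (auto intro: suminf_nonneg sm)
  then show ?thesis using sm by (simp add: sums_iff)
qed

text \<open>Almost surely there is a winner; otherwise the index is an arbitrary number, and still
  a measurable function.\<close>

definition winner_index :: "(nat \<Rightarrow> 'z set) \<Rightarrow> (nat \<Rightarrow> (nat \<Rightarrow> 'z) \<times> (nat \<Rightarrow> real)) \<Rightarrow> nat" where
  "winner_index S \<omega> = (LEAST n. winner S \<omega> (fst (prod_decode n)) (snd (prod_decode n)))"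

definition select :: "'b measure \<Rightarrow> ('b \<Rightarrow> real) \<Rightarrow> (nat \<Rightarrow> (nat \<Rightarrow> 'b \<times> real) \<times> (nat \<Rightarrow> real)) \<Rightarrow> 'b" where
  "select P h \<omega> = (let (k, j) = prod_decode (winner_index (slab P h) \<omega>) in fst (fst (\<omega> k) j))"

lemma select_winner:
  assumes "winner (slab P h) \<omega> k j"
  shows "select P h \<omega> = fst (fst (\<omega> k) j)"
proof -
  have "winner_index (slab P h) \<omega> = prod_encode (k, j)"
    unfolding winner_index_def
  proof (rule Least_equality)
    fix n assume "winner (slab P h) \<omega> (fst (prod_decode n)) (snd (prod_decode n))"
    then have "prod_decode n = (k, j)" using winner_unique[OF assms] by (metis prod.collapse)
    then show "prod_encode (k, j) \<le> n" by (metis order_refl prod_decode_inverse)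
  qed (simp add: assms)
  then show ?thesis by (simp add: select_def)
qed

text \<open>Joint measurability of \<open>f\<close> enters here: winning is a measurable condition
  on input and process together. For each value of the index the output is a coordinate map.\<close>

lemma select_measurable:
  assumes f[measurable]: "f \<in> borel_measurable (M \<Otimes>\<^sub>M P)"
  shows "(\<lambda>(I, \<omega>). select P (\<lambda>y. f (I, y)) \<omega>) \<in> M \<Otimes>\<^sub>M layers (mark_space P) \<rightarrow>\<^sub>M P"
proof -
  let ?K = "M \<Otimes>\<^sub>M layers (mark_space P)"
  have mark[measurable]: "(\<lambda>x. fst (snd x k) j) \<in> ?K \<rightarrow>\<^sub>M P \<Otimes>\<^sub>M borel" for k j
    by measurable
  have [measurable]: "Measurable.pred ?K (\<lambda>x. fst (snd x k) j \<in> slab P (\<lambda>y. f (fst x, y)) k)" for k j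
    unfolding slab_def mem_Collect_eq by measurable
  have [measurable]: "Measurable.pred ?K (\<lambda>x. winner (slab P (\<lambda>y. f (fst x, y))) (snd x) k j)" for k j
    unfolding winner_def first_hit_def by measurable
  have idx: "(\<lambda>x. winner_index (slab P (\<lambda>y. f (fst x, y))) (snd x)) \<in> ?K \<rightarrow>\<^sub>M count_space UNIV"
    unfolding winner_index_def by measurable
  have "(\<lambda>x. fst (fst (snd x (fst (prod_decode n))) (snd (prod_decode n)))) \<in> ?K \<rightarrow>\<^sub>M P" for n
    by (rule measurable_compose[OF mark measurable_fst])
  from measurable_compose_countable[where f="\<lambda>n x. fst (fst (snd x (fst (prod_decode n))) (snd (prod_decode n)))", OF this idx]
  show ?thesis
    by (simp add: select_def split_beta' Let_def)
qed

lemma select_measurable':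
  assumes h[measurable]: "h \<in> borel_measurable P"
  shows "select P h \<in> layers (mark_space P) \<rightarrow>\<^sub>M P"
proof -
  have "(\<lambda>(I, \<omega>). select P (\<lambda>y. (h \<circ> snd) (I, y)) \<omega>) \<in> count_space UNIV \<Otimes>\<^sub>M layers (mark_space P) \<rightarrow>\<^sub>M P"
    by (intro select_measurable) auto
  from measurable_Pair2[OF this] show ?thesis by simp
qed

lemma measure_winner_slab:
  assumes P: "prob_space P" and h: "integrable P h" and b: "integrable P b"
    and le: "\<And>x. 0 \<le> b x" "\<And>x. b x \<le> h x" and pos: "0 < (\<integral>x. h x \<partial>P)"
  shows "measure (layers (mark_space P)) {\<omega> \<in> space (layers (mark_space P)).
      \<exists>k j. winner (slab P h) \<omega> k j \<and> fst (\<omega> k) j \<in> slab P b k} = (\<integral>x. b x \<partial>P) / (\<integral>x. h x \<partial>P)"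
proof (rule measure_winner)
  have [measurable]: "h \<in> borel_measurable P" "b \<in> borel_measurable P" using h b by auto
  show "slab P h k \<in> sets (mark_space P)" "slab P b k \<in> sets (mark_space P)" for k
    by measurable
  show "slab P b k \<subseteq> slab P h k" for k
    using le(2) by (auto simp: slab_def intro: less_le_trans)
  show "(\<lambda>k. measure (mark_space P) (slab P h k)) sums (\<integral>x. h x \<partial>P)"
    using P h order_trans[OF le] by (rule sums_measure_slab)
  show "(\<lambda>k. measure (mark_space P) (slab P b k)) sums (\<integral>x. b x \<partial>P)"
    using P b le(1) by (rule sums_measure_slab)
qed (intro prob_space_mark_space P pos)+

section \<open>Output law and agreement probability\<close>

lemma integral_prob_density:
  fixes g :: "'b \<Rightarrow> real"
  assumes g[measurable]: "g \<in> borel_measurable P" and nonneg: "\<And>x. 0 \<le> g x"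
    and G: "prob_space (density P (\<lambda>x. ennreal (g x)))"
  shows "integrable P g" "(\<integral>x. g x \<partial>P) = 1"
proof -
  have one: "(\<integral>\<^sup>+x. ennreal (g x) \<partial>P) = 1"
    using prob_space.emeasure_space_1[OF G] by (simp add: emeasure_density cong: nn_integral_cong)
  then show int: "integrable P g" using nonneg by (intro integrableI_nonneg) auto
  then have "ennreal (\<integral>x. g x \<partial>P) = 1"
    using one nonneg by (subst nn_integral_eq_integral[symmetric]) auto
  then show "(\<integral>x. g x \<partial>P) = 1" by simp
qed

text \<open>The output lies in \<open>B\<close> if the winner lies below
  \<open>h * indicator B\<close>, which gives one inequality for every \<open>B\<close>. Applied to
  complements it gives the other, both sides being probability measures. The arbitrary output on the
  null event without winner thus needs no separate treatment.\<close>

lemma distr_select: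
  assumes P: "prob_space P" and h: "h \<in> borel_measurable P" and nonneg: "\<And>x. 0 \<le> h x"
    and Q: "prob_space (density P (\<lambda>x. ennreal (h x)))"
  shows "distr (layers (mark_space P)) P (select P h) = density P (\<lambda>x. ennreal (h x))"
proof -
  let ?L = "layers (mark_space P)" and ?D = "density P (\<lambda>x. ennreal (h x))"
  interpret P: prob_space P by fact
  interpret L: prob_space ?L by (intro prob_space_layers prob_space_mark_space P)
  interpret D: prob_space ?D by fact
  note [measurable] = h
  have sel[measurable]: "select P h \<in> ?L \<rightarrow>\<^sub>M P" by (rule select_measurable'[OF h])
  interpret \<nu>: prob_space "distr ?L P (select P h)" by (rule L.prob_space_distr[OF sel])
  have int: "integrable P h" and int1: "(\<integral>x. h x \<partial>P) = 1"
    using integral_prob_density[OF h nonneg Q] .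
  have le: "measure ?D B \<le> measure (distr ?L P (select P h)) B" if B[measurable]: "B \<in> sets P" for B
  proof -
    let ?b = "\<lambda>x. h x * indicator B x"
    have "measure ?D B = (\<integral>x. ?b x \<partial>P) / (\<integral>x. h x \<partial>P)"
      using measure_density_eq_integral[OF h B nonneg] by (simp add: int1)
    also have "\<dots> = measure ?L {\<omega> \<in> space ?L. \<exists>k j. winner (slab P h) \<omega> k j \<and> fst (\<omega> k) j \<in> slab P ?b k}"
      using nonneg int1 int integrable_real_mult_indicator[OF B int]
      by (intro measure_winner_slab[symmetric] P) (auto simp: indicator_def)
    also have "\<dots> \<le> measure ?L (select P h -` B \<inter> space ?L)"
    proof (rule L.finite_measure_mono)
      show "{\<omega> \<in> space ?L. \<exists>k j. winner (slab P h) \<omega> k j \<and> fst (\<omega> k) j \<in> slab P ?b k}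
        \<subseteq> select P h -` B \<inter> space ?L"
      proof
        fix \<omega> assume "\<omega> \<in> {\<omega> \<in> space ?L. \<exists>k j. winner (slab P h) \<omega> k j \<and> fst (\<omega> k) j \<in> slab P ?b k}"
        then obtain k j where w: "winner (slab P h) \<omega> k j" and b: "fst (\<omega> k) j \<in> slab P ?b k"
          and sp: "\<omega> \<in> space ?L" by blast
        from b have "0 < ?b (fst (fst (\<omega> k) j))" by (simp add: slab_def)
        then have "select P h \<omega> \<in> B"
          unfolding select_winner[OF w] by (cases "fst (fst (\<omega> k) j) \<in> B") simp_all
        with sp show "\<omega> \<in> select P h -` B \<inter> space ?L" by simp
      qed
    qed measurable
    also have "\<dots> = measure (distr ?L P (select P h)) B"
      by (simp add: measure_distr)
    finally show ?thesis .
  qed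
  show ?thesis
  proof (rule measure_eqI)
    fix B assume "B \<in> sets (distr ?L P (select P h))"
    then have B: "B \<in> sets P" by simp
    have "measure (distr ?L P (select P h)) (space P - B) = 1 - measure (distr ?L P (select P h)) B"
      using \<nu>.prob_compl[of B] B by simp
    moreover have "measure ?D (space P - B) = 1 - measure ?D B"
      using D.prob_compl[of B] B by simp
    ultimately have "measure (distr ?L P (select P h)) B = measure ?D B"
      using le[OF B] le[of "space P - B"] B by auto
    then show "emeasure (distr ?L P (select P h)) B = emeasure ?D B"
      by (simp add: \<nu>.emeasure_eq_measure D.emeasure_eq_measure)
  qed simp
qed

text \<open>Gaps range over all reals and are nonnegative only almost surely, whereas
  \<open>winner_subfamily\<close> asks for this pointwise.\<close>

lemma AE_gaps_nonneg:
  assumes Q: "prob_space Q"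
  shows "AE \<omega> in layers Q. \<forall>k i. 0 \<le> snd (\<omega> k) i"
proof -
  interpret M: prob_space "PiM UNIV (\<lambda>_::nat. Q)" by (intro prob_space_PiM Q)
  interpret G: prob_space gaps by (rule prob_space_gaps)
  interpret MG: pair_sigma_finite "PiM UNIV (\<lambda>_::nat. Q)" gaps ..
  have "AE w in density lborel (exponential_density 1). 0 \<le> w"
    by (subst AE_density) (auto simp: exponential_density_def)
  then have "AE w in gaps. 0 \<le> w i" for i
    unfolding gaps_def by (intro AE_PiM_component prob_space_exponential) auto
  then have G0: "AE w in gaps. \<forall>i. 0 \<le> w i" by (simp add: AE_all_countable)
  have L: "AE x in layer Q. \<forall>i. 0 \<le> snd x i"
  proof -
    have "{x \<in> space (layer Q). \<forall>i. 0 \<le> snd x i} \<in> sets (layer Q)" by measurable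
    then show ?thesis
      using G0 unfolding layer_def by (intro MG.AE_pair_measure) auto
  qed
  have "AE \<omega> in layers Q. \<forall>i. 0 \<le> snd (\<omega> k) i" for k
    unfolding layers_def
    using AE_PiM_component[of UNIV "\<lambda>_. layer Q" k "\<lambda>x. \<forall>i. 0 \<le> snd x i", OF prob_space_layer[OF Q] UNIV_I L]
    by simp
  then show ?thesis by (simp add: AE_all_countable)
qed

text \<open>A winner for the region below \<open>max h h'\<close> that lies below \<open>min h h'\<close> wins for both \<open>h\<close> and \<open>h'\<close>.\<close>

lemma prob_select_eq:
  assumes N: "separated_countably_generated P" and P: "prob_space P"
    and h: "integrable P h" "\<And>x. 0 \<le> h x" and h': "integrable P h'" "\<And>x. 0 \<le> h' x"
    and pos: "0 < (\<integral>x. max (h x) (h' x) \<partial>P)"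
  shows "(\<integral>x. min (h x) (h' x) \<partial>P) / (\<integral>x. max (h x) (h' x) \<partial>P)
    \<le> measure (layers (mark_space P)) {\<omega> \<in> space (layers (mark_space P)). select P h \<omega> = select P h' \<omega>}"
proof -
  let ?L = "layers (mark_space P)"
  interpret L: prob_space ?L by (intro prob_space_layers prob_space_mark_space P)
  let ?max = "\<lambda>x. max (h x) (h' x)" and ?min = "\<lambda>x. min (h x) (h' x)"
  have "Measurable.pred ?L (\<lambda>\<omega>. select P h \<omega> \<noteq> select P h' \<omega>)"
    using h h' by (intro pred_neq_measurable[OF N] select_measurable') auto
  then have m: "{\<omega> \<in> space ?L. select P h \<omega> = select P h' \<omega>} \<in> sets ?L"
    using pred_intros_logic(2) unfolding pred_def by fastforce
  have "(\<integral>x. ?min x \<partial>P) / (\<integral>x. ?max x \<partial>P) = measure ?L {\<omega> \<in> space ?L.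
      \<exists>k j. winner (slab P ?max) \<omega> k j \<and> fst (\<omega> k) j \<in> slab P ?min k}"
    using h h' by (intro measure_winner_slab[symmetric] P pos) auto
  also have "\<dots> \<le> measure ?L {\<omega> \<in> space ?L. select P h \<omega> = select P h' \<omega>}"
  proof (rule L.finite_measure_mono_AE[OF _ m])
    show "AE \<omega> in ?L. \<omega> \<in> {\<omega> \<in> space ?L. \<exists>k j. winner (slab P ?max) \<omega> k j \<and> fst (\<omega> k) j \<in> slab P ?min k}
      \<longrightarrow> \<omega> \<in> {\<omega> \<in> space ?L. select P h \<omega> = select P h' \<omega>}"
      using AE_gaps_nonneg[OF prob_space_mark_space[OF P]]
    proof eventually_elim
      case (elim \<omega>)
      have "select P h \<omega> = select P h' \<omega>"
        if w: "winner (slab P ?max) \<omega> k j" and m: "fst (\<omega> k) j \<in> slab P ?min k" for k j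
      proof -
        have "winner (slab P h) \<omega> k j" "winner (slab P h') \<omega> k j"
          using m elim by (auto intro!: winner_subfamily[OF w] simp: slab_def)
        then show ?thesis by (simp add: select_winner)
      qed
      then show ?case by blast
    qed
  qed
  finally show ?thesis .
qed

lemma prob_select_neq_le:
  assumes N: "separated_countably_generated P" and P: "prob_space P"
    and h: "h \<in> borel_measurable P" "\<And>x. 0 \<le> h x" and h': "h' \<in> borel_measurable P" "\<And>x. 0 \<le> h' x"
    and D: "prob_space (density P (\<lambda>x. ennreal (h x)))" and D': "prob_space (density P (\<lambda>x. ennreal (h' x)))"
  defines "d \<equiv> tv_dist P (density P (\<lambda>x. ennreal (h x))) (density P (\<lambda>x. ennreal (h' x)))"
  shows "measure (layers (mark_space P)) {\<omega> \<in> space (layers (mark_space P)). select P h \<omega> \<noteq> select P h' \<omega>}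
    \<le> 2 * d / (1 + d)"
proof -
  let ?L = "layers (mark_space P)"
  let ?D = "density P (\<lambda>x. ennreal (h x))" and ?D' = "density P (\<lambda>x. ennreal (h' x))"
  interpret L: prob_space ?L by (intro prob_space_layers prob_space_mark_space P)
  have i: "integrable P h" "(\<integral>x. h x \<partial>P) = 1" and i': "integrable P h'" "(\<integral>x. h' x \<partial>P) = 1"
    using integral_prob_density[OF h D] integral_prob_density[OF h' D'] by auto
  note [measurable] = h(1) h'(1)
  define m where "m = (\<integral>x. min (h x) (h' x) \<partial>P)"
  have "(\<integral>x. min (h x) (h' x) + max (h x) (h' x) \<partial>P) = (\<integral>x. h x + h' x \<partial>P)"
    by (intro Bochner_Integration.integral_cong) auto
  then have mx: "(\<integral>x. max (h x) (h' x) \<partial>P) = 2 - m"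
    using i i' by (simp add: m_def)
  have m1: "m \<le> 1"
    unfolding m_def i(2)[symmetric] using i i' by (intro integral_mono) auto
  \<comment> \<open>This set carries the whole excess of \<open>h\<close> over the minimum, so its
    two probabilities differ by exactly \<open>1 - m\<close>.\<close>
  let ?S = "{x \<in> space P. h' x < h x}"
  have S: "?S \<in> sets P" by measurable
  have "1 - m = (\<integral>x. h x - min (h x) (h' x) \<partial>P)"
    using i i' by (simp add: m_def)
  also have "\<dots> = (\<integral>x. h x * indicator ?S x - h' x * indicator ?S x \<partial>P)"
    by (intro Bochner_Integration.integral_cong) (auto simp: indicator_def)
  also have "\<dots> = measure ?D ?S - measure ?D' ?S"
    using measure_density_eq_integral[OF h(1) S h(2)] measure_density_eq_integral[OF h'(1) S h'(2)]
      integrable_real_mult_indicator[OF S i(1)] integrable_real_mult_indicator[OF S i'(1)]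
    by simp
  also have "\<dots> \<le> d" unfolding d_def by (rule tv_dist_upper[OF D D' S])
  finally have md: "1 - m \<le> d" .
  have pos: "0 < (\<integral>x. max (h x) (h' x) \<partial>P)" using mx m1 by simp
  have neq: "{\<omega> \<in> space ?L. select P h \<omega> \<noteq> select P h' \<omega>} \<in> sets ?L"
    using pred_neq_measurable[OF N select_measurable'[OF h(1)] select_measurable'[OF h'(1)]]
    by (simp add: pred_def)
  have "{\<omega> \<in> space ?L. select P h \<omega> = select P h' \<omega>}
    = space ?L - {\<omega> \<in> space ?L. select P h \<omega> \<noteq> select P h' \<omega>}" by auto
  then have "measure ?L {\<omega> \<in> space ?L. select P h \<omega> \<noteq> select P h' \<omega>} \<le> 1 - m / (2 - m)"
    using prob_select_eq[OF N P i(1) h(2) i'(1) h'(2) pos] L.prob_compl[OF neq]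
    by (simp add: mx m_def)
  \<comment> \<open>In this form the bound is visibly increasing in \<open>1 - m\<close>, so
    \<open>1 - m \<le> d\<close> can be inserted.\<close>
  also have "1 - m / (2 - m) = 2 - 2 / (1 + (1 - m))"
    using m1 by (simp add: field_simps)
  also have "\<dots> \<le> 2 - 2 / (1 + d)"
    using md m1 by (intro diff_left_mono divide_left_mono) auto
  also have "\<dots> = 2 * d / (1 + d)"
    using md m1 by (simp add: field_simps)
  finally show ?thesis .
qed

section \<open>Transport to the seed type\<close>

text \<open>The type \<open>'b seed\<close> is prescribed, so mark, height within the layer and gap
  of point \<open>j\<close> of layer \<open>k\<close> are stored together at
  \<open>(k, j)\<close>.\<close>

definition pack :: "(nat \<Rightarrow> (nat \<Rightarrow> 'b \<times> real) \<times> (nat \<Rightarrow> real)) \<Rightarrow> 'b seed" where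
  "pack \<omega> = (\<lambda>(k, j). (fst (fst (\<omega> k) j), snd (fst (\<omega> k) j), snd (\<omega> k) j))"

definition unpack :: "'b seed \<Rightarrow> nat \<Rightarrow> (nat \<Rightarrow> 'b \<times> real) \<times> (nat \<Rightarrow> real)" where
  "unpack r = (\<lambda>k. (\<lambda>j. (fst (r (k, j)), fst (snd (r (k, j)))), \<lambda>j. snd (snd (r (k, j)))))"

lemma unpack_pack: "unpack (pack \<omega>) = \<omega>"
  by (simp add: pack_def unpack_def)

lemma pack_measurable:
  "pack \<in> layers (mark_space P) \<rightarrow>\<^sub>M PiM UNIV (\<lambda>_. P \<Otimes>\<^sub>M borel \<Otimes>\<^sub>M borel)"
proof (rule measurable_PiM_single')
  fix kj :: "nat \<times> nat"
  have [measurable]: "(\<lambda>\<omega>. fst (\<omega> k) j) \<in> layers (mark_space P) \<rightarrow>\<^sub>M P \<Otimes>\<^sub>M borel" for k j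
    by measurable
  have "(\<lambda>\<omega>. (fst (fst (\<omega> (fst kj)) (snd kj)), snd (fst (\<omega> (fst kj)) (snd kj)), snd (\<omega> (fst kj)) (snd kj)))
    \<in> layers (mark_space P) \<rightarrow>\<^sub>M P \<Otimes>\<^sub>M borel \<Otimes>\<^sub>M borel"
    by measurable
  then show "(\<lambda>\<omega>. pack \<omega> kj) \<in> layers (mark_space P) \<rightarrow>\<^sub>M P \<Otimes>\<^sub>M borel \<Otimes>\<^sub>M borel"
    by (simp add: pack_def split_beta')
next
  have "\<omega> \<in> space (layers (mark_space P)) \<Longrightarrow> fst (fst (\<omega> k) j) \<in> space P" for \<omega> k j
    by (auto simp: layers_def layer_def mark_space_def space_PiM space_pair_measure PiE_iff mem_Times_iff)
  then show "pack \<in> space (layers (mark_space P)) \<rightarrow> (\<Pi>\<^sub>E kj\<in>UNIV. space (P \<Otimes>\<^sub>M borel \<Otimes>\<^sub>M borel))"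
    by (auto simp: pack_def space_pair_measure)
qed

lemma unpack_measurable:
  "unpack \<in> PiM UNIV (\<lambda>_. P \<Otimes>\<^sub>M borel \<Otimes>\<^sub>M borel) \<rightarrow>\<^sub>M layers (mark_space P)"
proof -
  let ?S = "PiM UNIV (\<lambda>_::nat \<times> nat. P \<Otimes>\<^sub>M borel \<Otimes>\<^sub>M borel)"
  have c[measurable]: "(\<lambda>r. r kj) \<in> ?S \<rightarrow>\<^sub>M P \<Otimes>\<^sub>M borel \<Otimes>\<^sub>M borel" for kj
    by (rule measurable_component_singleton) simp
  have "(\<lambda>r. \<lambda>j. (fst (r (k, j)), fst (snd (r (k, j))))) \<in> ?S \<rightarrow>\<^sub>M PiM UNIV (\<lambda>_. P \<Otimes>\<^sub>M borel)" for k :: nat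
    by (rule measurable_PiM_single') (auto simp: space_PiM space_pair_measure PiE_iff mem_Times_iff)
  moreover have "(\<lambda>r. \<lambda>j. snd (snd (r (k, j)))) \<in> ?S \<rightarrow>\<^sub>M PiM UNIV (\<lambda>_. borel)" for k :: nat
    by (rule measurable_PiM_single') auto
  ultimately have u: "(\<lambda>r. unpack r k) \<in> ?S \<rightarrow>\<^sub>M PiM UNIV (\<lambda>_. P \<Otimes>\<^sub>M borel) \<Otimes>\<^sub>M PiM UNIV (\<lambda>_. borel)" for k
    unfolding unpack_def by (intro measurable_Pair)
  have "sets (layer (mark_space P)) = sets (PiM UNIV (\<lambda>_. P \<Otimes>\<^sub>M borel) \<Otimes>\<^sub>M PiM UNIV (\<lambda>_. borel))"
    unfolding sets_layer by (intro sets_pair_measure_cong sets_PiM_cong refl sets_mark_space)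
  then have u': "(\<lambda>r. unpack r k) \<in> ?S \<rightarrow>\<^sub>M layer (mark_space P)" for k
    using u by (simp cong: measurable_cong_sets)
  show ?thesis
    unfolding layers_def
  proof (rule measurable_PiM_single')
    show "unpack \<in> space ?S \<rightarrow> (\<Pi>\<^sub>E k\<in>UNIV. space (layer (mark_space P)))"
      using measurable_space[OF u'] by auto
  qed (rule u')
qed

section \<open>Averaging over the inputs\<close>

text \<open>The right side is the tangent at \<open>\<rho>\<close> of the concave function
  \<open>2 * d / (1 + d)\<close>, whose derivative is \<open>2 / (1 + d)\<^sup>2\<close>. It is
  affine in \<open>d\<close>, so its average depends on the mean distance only.\<close>

lemma tangent_bound:
  fixes d \<rho> :: real
  assumes "0 \<le> d" "0 \<le> \<rho>"
  shows "2 * d / (1 + d) \<le> 2 * \<rho> / (1 + \<rho>) + 2 * (d - \<rho>) / (1 + \<rho>)\<^sup>2"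
proof -
  have "2 * \<rho> / (1 + \<rho>) + 2 * (d - \<rho>) / (1 + \<rho>)\<^sup>2 - 2 * d / (1 + d)
      = 2 * (d - \<rho>)\<^sup>2 / ((1 + d) * (1 + \<rho>)\<^sup>2)"
    using assms by (simp add: divide_simps add_nonneg_eq_0_iff) (simp add: power2_eq_square algebra_simps)
  also have "\<dots> \<ge> 0" using assms by simp
  finally show ?thesis by simp
qed

lemma tv_indistinguishable_imp_replicable:
  fixes M :: "'a measure" and N :: "'b measure"
  assumes N: "separated_countably_generated N" and P: "P \<in> space (prob_algebra N)"
    and A: "learning_rule M N A" and tv: "tv_indistinguishable M N A \<rho>" and ac: "abs_continuous_rule M P A"
  shows "\<exists>(R :: 'b seed measure) F. implements M N R F A \<and> replicable M R F (2 * \<rho> / (1 + \<rho>))"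
proof -
  have A': "A \<in> M \<rightarrow>\<^sub>M prob_algebra N" using A by (simp add: learning_rule_def)
  have PP: "prob_space P" and setsP[measurable_cong]: "sets P = sets N"
    using P by (auto simp: space_prob_algebra)
  have spP: "space P = space N" using setsP by (rule sets_eq_imp_space_eq)
  have NP: "separated_countably_generated P"
    using N unfolding separated_countably_generated_def setsP spP .
  \<comment> \<open>Dirac distributions turn almost every \<open>I\<close> into every \<open>I\<close>.\<close>
  have ac': "absolutely_continuous P (A I)" if I: "I \<in> space M" for I
  proof -
    have "return M I \<in> space (prob_algebra M)"
      using prob_space_return[OF I] by (simp add: space_prob_algebra)
    then have "AE I' in return M I. absolutely_continuous P (A I')"
      using ac unfolding abs_continuous_rule_def by blast
    then obtain Z where Z: "Z \<in> sets M" "emeasure (return M I) Z = 0"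
      "{I' \<in> space M. \<not> absolutely_continuous P (A I')} \<subseteq> Z"
      by (auto elim!: AE_E)
    have "I \<notin> Z" using Z(1,2) by (auto simp: indicator_def split: if_splits)
    then show ?thesis using Z(3) I by blast
  qed
  obtain f :: "'a \<times> 'b \<Rightarrow> real" where f: "f \<in> borel_measurable (M \<Otimes>\<^sub>M N)" "\<And>x. 0 \<le> f x"
    and Af: "\<And>I. I \<in> space M \<Longrightarrow> A I = density P (\<lambda>y. ennreal (f (I, y)))"
    using ex_jointly_measurable_density[OF N P A' ac'] by blast
  have fP: "f \<in> borel_measurable (M \<Otimes>\<^sub>M P)" using f(1) by measurable
  have fI: "(\<lambda>y. f (I, y)) \<in> borel_measurable P" if "I \<in> space M" for I
    using measurable_Pair2[OF fP that] .
  let ?L = "layers (mark_space P)"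
  let ?S = "PiM UNIV (\<lambda>_::nat \<times> nat. P \<Otimes>\<^sub>M (borel :: real measure) \<Otimes>\<^sub>M (borel :: real measure))"
  interpret L: prob_space ?L by (intro prob_space_layers prob_space_mark_space PP)
  \<comment> \<open>By \<open>unpack_pack\<close>, probabilities about \<open>F\<close> under
    \<open>R\<close> are probabilities about \<open>select\<close> under \<open>?L\<close>.\<close>
  define R where "R = distr ?L ?S pack"
  define F where "F I r = select P (\<lambda>y. f (I, y)) (unpack r)" for I r
  interpret R: prob_space R unfolding R_def by (rule L.prob_space_distr[OF pack_measurable])
  have setsR[measurable_cong]: "sets R = sets ?S" by (simp add: R_def)
  have un: "unpack \<in> R \<rightarrow>\<^sub>M ?L"
    using unpack_measurable setsR by (simp cong: measurable_cong_sets)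
  have "(\<lambda>x. (fst x, unpack (snd x))) \<in> M \<Otimes>\<^sub>M R \<rightarrow>\<^sub>M M \<Otimes>\<^sub>M ?L"
    using measurable_compose[OF measurable_snd un] by measurable
  from measurable_compose[OF this select_measurable[OF fP]]
  have Fm: "(\<lambda>(I, r). F I r) \<in> M \<Otimes>\<^sub>M R \<rightarrow>\<^sub>M P"
    by (simp add: F_def split_beta')
  have FIm: "F I \<in> R \<rightarrow>\<^sub>M P" if "I \<in> space M" for I
    using measurable_Pair2[OF Fm that] by simp
  have law: "distr R N (F I) = A I" if I: "I \<in> space M" for I
  proof -
    have "distr R N (F I) = distr R P (F I)" by (intro distr_cong refl setsP[symmetric])
    also have "\<dots> = distr ?L P (F I \<circ> pack)"
      using FIm[OF I] setsR unfolding R_def by (intro distr_distr pack_measurable) (simp cong: measurable_cong_sets)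
    also have "F I \<circ> pack = select P (\<lambda>y. f (I, y))"
      by (simp add: F_def unpack_pack fun_eq_iff)
    also have "distr ?L P (select P (\<lambda>y. f (I, y))) = A I"
      unfolding Af[OF I] using kernel_space(1)[OF A' I] Af[OF I]
      by (intro distr_select PP fI[OF I] f(2)) simp
    finally show ?thesis .
  qed
  have imp: "implements M N R F A"
    unfolding implements_def
  proof (intro conjI ballI R.prob_space_axioms law)
    show "(\<lambda>(I, r). F I r) \<in> M \<Otimes>\<^sub>M R \<rightarrow>\<^sub>M N"
      using Fm setsP by (simp cong: measurable_cong_sets)
  qed
  have neq: "emeasure R {r \<in> space R. F I r \<noteq> F I' r} \<le> ennreal (2 * tv_dist N (A I) (A I') / (1 + tv_dist N (A I) (A I')))"
    if I: "I \<in> space M" and I': "I' \<in> space M" for I I'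
  proof -
    have E: "{r \<in> space R. F I r \<noteq> F I' r} \<in> sets ?S"
      using pred_neq_measurable[OF NP FIm[OF I] FIm[OF I']] setsR by (simp add: pred_def)
    have "emeasure R {r \<in> space R. F I r \<noteq> F I' r}
      = emeasure ?L (pack -` {r \<in> space R. F I r \<noteq> F I' r} \<inter> space ?L)"
      unfolding R_def by (rule emeasure_distr[OF pack_measurable E[unfolded R_def]])
    also have "pack -` {r \<in> space R. F I r \<noteq> F I' r} \<inter> space ?L
      = {\<omega> \<in> space ?L. select P (\<lambda>y. f (I, y)) \<omega> \<noteq> select P (\<lambda>y. f (I', y)) \<omega>}"
      using measurable_space[OF pack_measurable] by (auto simp: F_def unpack_pack R_def)
    also have "emeasure ?L \<dots> \<le> ennreal (2 * tv_dist P (A I) (A I') / (1 + tv_dist P (A I) (A I')))"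
      unfolding L.emeasure_eq_measure Af[OF I] Af[OF I']
      using kernel_space(1)[OF A' I] kernel_space(1)[OF A' I'] Af[OF I] Af[OF I']
      by (intro ennreal_leI prob_select_neq_le NP PP fI I I' f(2)) simp_all
    also have "tv_dist P (A I) (A I') = tv_dist N (A I) (A I')"
      by (simp add: tv_dist_def setsP)
    finally show ?thesis .
  qed
  have "replicable M R F (2 * \<rho> / (1 + \<rho>))"
    unfolding replicable_iff
  proof (intro ballI conjI)
    fix \<mu> assume \<mu>: "\<mu> \<in> space (prob_algebra M)"
    interpret \<mu>: prob_space \<mu> using \<mu> by (simp add: space_prob_algebra)
    have [measurable_cong]: "sets \<mu> = sets M" using \<mu> by (simp add: space_prob_algebra)
    then have sp: "space \<mu> = space M" by (rule sets_eq_imp_space_eq)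
    interpret \<mu>2: pair_prob_space \<mu> \<mu> ..
    interpret W: pair_prob_space "\<mu> \<Otimes>\<^sub>M \<mu>" R ..
    let ?E = "{x \<in> space ((\<mu> \<Otimes>\<^sub>M \<mu>) \<Otimes>\<^sub>M R). F (fst (fst x)) (snd x) \<noteq> F (snd (fst x)) (snd x)}"
    let ?d = "\<lambda>x. case x of (I, I') \<Rightarrow> tv_dist N (A I) (A I')"
    have Fm': "(\<lambda>(I, r). F I r) \<in> \<mu> \<Otimes>\<^sub>M R \<rightarrow>\<^sub>M P" using Fm by measurable
    have "(\<lambda>x. F (fst (fst x)) (snd x)) \<in> (\<mu> \<Otimes>\<^sub>M \<mu>) \<Otimes>\<^sub>M R \<rightarrow>\<^sub>M P"
      using measurable_compose[OF measurable_Pair[OF measurable_compose[OF measurable_fst measurable_fst]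
            measurable_snd] Fm'] by simp
    moreover have "(\<lambda>x. F (snd (fst x)) (snd x)) \<in> (\<mu> \<Otimes>\<^sub>M \<mu>) \<Otimes>\<^sub>M R \<rightarrow>\<^sub>M P"
      using measurable_compose[OF measurable_Pair[OF measurable_compose[OF measurable_fst measurable_snd]
            measurable_snd] Fm'] by simp
    ultimately show E: "?E \<in> sets ((\<mu> \<Otimes>\<^sub>M \<mu>) \<Otimes>\<^sub>M R)"
      using pred_neq_measurable[OF NP] unfolding pred_def by blast
    have int: "integrable (\<mu> \<Otimes>\<^sub>M \<mu>) ?d" and le: "(\<integral>x. ?d x \<partial>(\<mu> \<Otimes>\<^sub>M \<mu>)) \<le> \<rho>"
      using tv \<mu> unfolding tv_indistinguishable_def by auto
    have d0: "0 \<le> ?d x" if "x \<in> space (\<mu> \<Otimes>\<^sub>M \<mu>)" for x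
      using that tv_dist_nonneg_le_1(1) kernel_space(1)[OF A'] by (auto simp: space_pair_measure sp)
    \<comment> \<open>The sign of \<open>\<rho>\<close> is no hypothesis; it follows from a
      nonnegative average being at most \<open>\<rho>\<close>.\<close>
    have "0 \<le> (\<integral>x. ?d x \<partial>(\<mu> \<Otimes>\<^sub>M \<mu>))" using d0 by (rule Bochner_Integration.integral_nonneg)
    then have \<rho>: "0 \<le> \<rho>" using le by simp
    let ?t = "\<lambda>x. 2 * \<rho> / (1 + \<rho>) + 2 * (?d x - \<rho>) / (1 + \<rho>)\<^sup>2"
    have t: "2 * ?d x / (1 + ?d x) \<le> ?t x" "0 \<le> ?t x" if "x \<in> space (\<mu> \<Otimes>\<^sub>M \<mu>)" for x
    proof -
      show "2 * ?d x / (1 + ?d x) \<le> ?t x" by (rule tangent_bound[OF d0[OF that] \<rho>])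
      moreover have "0 \<le> 2 * ?d x / (1 + ?d x)" using d0[OF that] by simp
      ultimately show "0 \<le> ?t x" by linarith
    qed
    have it: "integrable (\<mu> \<Otimes>\<^sub>M \<mu>) ?t" using int by simp
    have "emeasure ((\<mu> \<Otimes>\<^sub>M \<mu>) \<Otimes>\<^sub>M R) ?E = (\<integral>\<^sup>+x. emeasure R (Pair x -` ?E) \<partial>(\<mu> \<Otimes>\<^sub>M \<mu>))"
      by (rule R.emeasure_pair_measure_alt[OF E])
    also have "\<dots> \<le> (\<integral>\<^sup>+x. ennreal (?t x) \<partial>(\<mu> \<Otimes>\<^sub>M \<mu>))"
    proof (rule nn_integral_mono)
      fix x assume x: "x \<in> space (\<mu> \<Otimes>\<^sub>M \<mu>)"
      then obtain I I' where I: "x = (I, I')" "I \<in> space M" "I' \<in> space M"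
        by (auto simp: space_pair_measure sp)
      have "Pair x -` ?E = {r \<in> space R. F I r \<noteq> F I' r}"
        using I by (auto simp: space_pair_measure sp)
      then have "emeasure R (Pair x -` ?E) \<le> ennreal (2 * ?d x / (1 + ?d x))"
        using neq[OF I(2,3)] I(1) by simp
      also have "\<dots> \<le> ennreal (?t x)" by (rule ennreal_leI[OF t(1)[OF x]])
      finally show "emeasure R (Pair x -` ?E) \<le> ennreal (?t x)" .
    qed
    also have "\<dots> = ennreal (\<integral>x. ?t x \<partial>(\<mu> \<Otimes>\<^sub>M \<mu>))"
      using it t(2) by (intro nn_integral_eq_integral AE_I2)
    also have "(\<integral>x. ?t x \<partial>(\<mu> \<Otimes>\<^sub>M \<mu>)) = 2 * \<rho> / (1 + \<rho>) + 2 * ((\<integral>x. ?d x \<partial>(\<mu> \<Otimes>\<^sub>M \<mu>)) - \<rho>) / (1 + \<rho>)\<^sup>2"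
      using int \<mu>2.P.prob_space by simp
    \<comment> \<open>The mean distance is at most \<open>\<rho>\<close>, so the linear term of the
      tangent is nonpositive on average.\<close>
    also have "ennreal \<dots> \<le> ennreal (2 * \<rho> / (1 + \<rho>))"
      using le by (intro ennreal_leI) (simp add: divide_nonpos_nonneg)
    finally show "measure ((\<mu> \<Otimes>\<^sub>M \<mu>) \<Otimes>\<^sub>M R) ?E \<le> 2 * \<rho> / (1 + \<rho>)"
      using \<rho> by (simp add: W.P.emeasure_eq_measure ennreal_le_iff)
  qed
  with imp show ?thesis by blast
qed

theorem proposition2:
  fixes M :: "'a measure" and N :: "'b measure"
  assumes "separated_countably_generated N"
  shows
    "(\<forall>(A :: 'a \<Rightarrow> 'b measure) (R :: 'r measure) F \<rho>.
        learning_rule M N A \<and> implements M N R F A \<and> replicable M R F \<rho>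
        \<longrightarrow> tv_indistinguishable M N A \<rho>) \<and>
     (\<forall>P (A :: 'a \<Rightarrow> 'b measure) \<rho>.
        P \<in> space (prob_algebra N) \<and> learning_rule M N A \<and>
        tv_indistinguishable M N A \<rho> \<and> abs_continuous_rule M P A
        \<longrightarrow> (\<exists>A'. learning_rule M N A' \<and> equivalent_rules M A A' \<and>
              (\<exists>(R :: 'b seed measure) F.
                 implements M N R F A' \<and> replicable M R F (2 * \<rho> / (1 + \<rho>)))))"
proof (intro conjI allI impI; elim conjE)
  show "tv_indistinguishable M N A \<rho>"
    if "learning_rule M N A" "implements M N R F A" "replicable M R F \<rho>" for A and R :: "'r measure" and F \<rho>
    using replicable_imp_tv_indistinguishable[OF assms that] .
  \<comment> \<open>\<open>A\<close> itself serves as \<open>A'\<close>: replicability concerns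
    \<open>R\<close> and \<open>F\<close>, so only the implementation is new.\<close>
  show "\<exists>A'. learning_rule M N A' \<and> equivalent_rules M A A' \<and>
          (\<exists>(R :: 'b seed measure) F. implements M N R F A' \<and> replicable M R F (2 * \<rho> / (1 + \<rho>)))"
    if "P \<in> space (prob_algebra N)" "learning_rule M N A" "tv_indistinguishable M N A \<rho>"
      "abs_continuous_rule M P A" for P A \<rho>
    using tv_indistinguishable_imp_replicable[OF assms that] that(2)
    by (auto simp: equivalent_rules_def intro!: exI[of _ A])
qed

end
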